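(* Let $M$ be a Hopf hypersurface of the homogeneous nearly K\"ahler $\mathbf{S}^3\times\mathbf{S}^3$ with three distinct principal curvatures and satisfying $P\{U\}^\perp=\{U\}^\perp$. If $P\xi=-\xi$, then, up to isometries of type $\mathcal{F}_{abc}$, $M$ is locally (an open part of) the image of the embedding $f_r''=\mathcal{F}_2\circ f_r:\mathbf{S}^3\times\mathbf{S}^2\to\mathbf{S}^3\times\mathbf{S}^3$ for some $0<r\le1$, where $f_r(x,y)=(x,\sqrt{1-r^2}+ry)$.
   Context: Regard $\mathbf{S}^3$ as unit quaternions and $\mathbf{S}^2$ as unit imaginary quaternions in $\mathbb{H}$; write tangent vectors at $(p,q)$ as $Z=(U,V)$. The homogeneous NK structure: $JZ=\tfrac{1}{\sqrt3}(2pq^{-1}V-U,\,-2qp^{-1}U+V)$, $g(Z,Z')=\tfrac43(\langle U,U'\rangle+\langle V,V'\rangle)-\tfrac23(\langle p^{-1}U,q^{-1}V'\rangle+\langle p^{-1}U',q^{-1}V\rangle)$; almost product structure $PZ=(pq^{-1}V,qp^{-1}U)$. $\mathcal{F}_2(p,q)=(\bar p,q\bar p)$ and, for unit quaternions $a,b,c$, $\mathcal{F}_{abc}(p,q)=(ap\bar c,bq\bar c)$ are isometries. For a connected orientable hypersurface $M$ with unit normal $\xi$ and shape operator $A$, $U=-J\xi$; $M$ is Hopf if the integral curves of $U$ are geodesics (equivalently $AU=\alpha U$). $\{U\}^\perp$ is the distribution of tangent vectors orthogonal to $U$. "Three distinct principal curvatures" means $A$ has exactly three distinct eigenvalues at every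 point. *)

theory Defs
  imports "HOL-Analysis.Analysis"
begin

section \<open>Quaternions, modelled as real^4 (index 1 = real part, 2,3,4 = i,j,k)\<close>

type_synonym quat = "real^4"

definition qmul :: "quat \<Rightarrow> quat \<Rightarrow> quat" where
  "qmul p q = (\<chi> i.
     if i = 1 then p$1*q$1 - p$2*q$2 - p$3*q$3 - p$4*q$4
     else if i = 2 then p$1*q$2 + p$2*q$1 + p$3*q$4 - p$4*q$3
     else if i = 3 then p$1*q$3 - p$2*q$4 + p$3*q$1 + p$4*q$2
     else p$1*q$4 + p$2*q$3 - p$3*q$2 + p$4*q$1)"

definition qcnj :: "quat \<Rightarrow> quat" where
  "qcnj p = (\<chi> i. if i = 1 then p$1 else - p$i)"

definition qinv :: "quat \<Rightarrow> quat" where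
  "qinv p = (1 / (norm p)^2) *\<^sub>R qcnj p"

definition qreal :: "real \<Rightarrow> quat" where
  "qreal r = (\<chi> i. if i = 1 then r else 0)"

definition S3 :: "quat set" where
  "S3 = {p. norm p = 1}"

definition S2 :: "quat set" where
  "S2 = {p. norm p = 1 \<and> p$1 = 0}"

definition NK :: "(quat \<times> quat) set" where
  "NK = S3 \<times> S3"

definition TN :: "quat \<times> quat \<Rightarrow> (quat \<times> quat) set" where
  "TN x = {Z. fst x \<bullet> fst Z = 0 \<and> snd x \<bullet> snd Z = 0}"

text \<open>The metric g (the formula makes sense for all p, q nonzero; it is a Riemannian metric
  on a neighbourhood of S3 x S3 in H x H extending the nearly Kaehler metric).\<close>
definition gNK :: "quat \<times> quat \<Rightarrow> quat \<times> quat \<Rightarrow> quat \<times> quat \<Rightarrow> real" where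
  "gNK x Z W =
     4/3 * (fst Z \<bullet> fst W + snd Z \<bullet> snd W)
     - 2/3 * ((qmul (qinv (fst x)) (fst Z)) \<bullet> (qmul (qinv (snd x)) (snd W))
            + (qmul (qinv (fst x)) (fst W)) \<bullet> (qmul (qinv (snd x)) (snd Z)))"

definition JNK :: "quat \<times> quat \<Rightarrow> quat \<times> quat \<Rightarrow> quat \<times> quat" where
  "JNK x Z =
     ((1 / sqrt 3) *\<^sub>R (2 *\<^sub>R qmul (qmul (fst x) (qinv (snd x))) (snd Z) - fst Z),
      (1 / sqrt 3) *\<^sub>R (- 2 *\<^sub>R qmul (qmul (snd x) (qinv (fst x))) (fst Z) + snd Z))"

definition PNK :: "quat \<times> quat \<Rightarrow> quat \<times> quat \<Rightarrow> quat \<times> quat" where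
  "PNK x Z = (qmul (qmul (fst x) (qinv (snd x))) (snd Z),
              qmul (qmul (snd x) (qinv (fst x))) (fst Z))"

definition dgNK :: "quat \<times> quat \<Rightarrow> quat \<times> quat \<Rightarrow> quat \<times> quat \<Rightarrow> quat \<times> quat \<Rightarrow> real" where
  "dgNK x X Y Z = frechet_derivative (\<lambda>y. gNK y Y Z) (at x) X"

text \<open>Levi-Civita connection of (S3 x S3, g): for a vector field Y along a curve/submanifold
  with value Yx at x and ambient (Euclidean) derivative DY in direction X at x,
  the covariant derivative is the unique tangent vector W with
  g(W,Z) = g(DY,Z) + 1/2 (X g(Y,Z) + Y g(X,Z) - Z g(X,Y)) for all tangent Z
  (Koszul formula / tangential projection of the ambient Levi-Civita connection).\<close>
definition nablaNK :: "quat \<times> quat \<Rightarrow> quat \<times> quat \<Rightarrow> quat \<times> quat \<Rightarrow> quat \<times> quat \<Rightarrow> quat \<times> quat" where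
  "nablaNK x X Yx DY = (THE W. W \<in> TN x \<and>
     (\<forall>Z\<in>TN x. gNK x W Z = gNK x DY Z + 1/2 * (dgNK x X Yx Z + dgNK x Yx X Z - dgNK x Z X Yx)))"

fun iter_dderiv :: "'a::real_normed_vector list \<Rightarrow> ('a \<Rightarrow> 'b::real_normed_vector) \<Rightarrow> 'a \<Rightarrow> 'b" where
  "iter_dderiv [] f = f"
| "iter_dderiv (v # vs) f = (\<lambda>x. frechet_derivative (iter_dderiv vs f) (at x) v)"

definition smooth_on :: "'a::real_normed_vector set \<Rightarrow> ('a \<Rightarrow> 'b::real_normed_vector) \<Rightarrow> bool" where
  "smooth_on S f \<longleftrightarrow> open S \<and> (\<forall>vs. iter_dderiv vs f differentiable_on S)"

text \<open>A smooth (embedded) hypersurface of S3 x S3: locally the regular zero set of a smooth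
  map to R^3 (codimension 3 in H x H = R^8, hence dimension 5).\<close>
definition hypersurface_NK :: "(quat \<times> quat) set \<Rightarrow> bool" where
  "hypersurface_NK M \<longleftrightarrow> M \<subseteq> NK \<and>
     (\<forall>x\<in>M. \<exists>Op (F :: quat \<times> quat \<Rightarrow> real^3). open Op \<and> x \<in> Op \<and> smooth_on Op F \<and>
        (\<forall>y\<in>Op. surj (frechet_derivative F (at y))) \<and> M \<inter> Op = {y\<in>Op. F y = 0})"

definition TM :: "(quat \<times> quat) set \<Rightarrow> quat \<times> quat \<Rightarrow> (quat \<times> quat) set" where
  "TM M x = {v. \<exists>\<gamma> e. e > 0 \<and> (\<forall>t\<in>{-e<..<e}. \<gamma> t \<in> M) \<and> \<gamma> 0 = x \<and>
                   (\<gamma> has_vector_derivative v) (at 0)}"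

definition unit_normal :: "(quat \<times> quat) set \<Rightarrow> (quat \<times> quat \<Rightarrow> quat \<times> quat) \<Rightarrow> bool" where
  "unit_normal M \<xi> \<longleftrightarrow> (\<forall>x\<in>M. \<xi> x \<in> TN x \<and> gNK x (\<xi> x) (\<xi> x) = 1 \<and>
      (\<forall>X\<in>TM M x. gNK x (\<xi> x) X = 0) \<and>
      (\<exists>Op \<eta>. open Op \<and> x \<in> Op \<and> smooth_on Op \<eta> \<and> (\<forall>y\<in>M \<inter> Op. \<eta> y = \<xi> y)))"

definition shapeop :: "(quat \<times> quat) set \<Rightarrow> (quat \<times> quat \<Rightarrow> quat \<times> quat) \<Rightarrow> quat \<times> quat \<Rightarrow> quat \<times> quat \<Rightarrow> quat \<times> quat" where
  "shapeop M \<xi> x X = - nablaNK x X (\<xi> x) (frechet_derivative \<xi> (at x within M) X)"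

definition Uvec :: "(quat \<times> quat \<Rightarrow> quat \<times> quat) \<Rightarrow> quat \<times> quat \<Rightarrow> quat \<times> quat" where
  "Uvec \<xi> x = - JNK x (\<xi> x)"

definition hopf :: "(quat \<times> quat) set \<Rightarrow> (quat \<times> quat \<Rightarrow> quat \<times> quat) \<Rightarrow> bool" where
  "hopf M \<xi> \<longleftrightarrow> (\<forall>x\<in>M. \<exists>\<alpha>. shapeop M \<xi> x (Uvec \<xi> x) = \<alpha> *\<^sub>R Uvec \<xi> x)"

definition principal_curvatures :: "(quat \<times> quat) set \<Rightarrow> (quat \<times> quat \<Rightarrow> quat \<times> quat) \<Rightarrow> quat \<times> quat \<Rightarrow> real set" where
  "principal_curvatures M \<xi> x = {k. \<exists>X\<in>TM M x. X \<noteq> 0 \<and> shapeop M \<xi> x X = k *\<^sub>R X}"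

definition Uperp :: "(quat \<times> quat) set \<Rightarrow> (quat \<times> quat \<Rightarrow> quat \<times> quat) \<Rightarrow> quat \<times> quat \<Rightarrow> (quat \<times> quat) set" where
  "Uperp M \<xi> x = {X\<in>TM M x. gNK x X (Uvec \<xi> x) = 0}"

definition F2 :: "quat \<times> quat \<Rightarrow> quat \<times> quat" where
  "F2 x = (qcnj (fst x), qmul (snd x) (qcnj (fst x)))"

definition Fabc :: "quat \<Rightarrow> quat \<Rightarrow> quat \<Rightarrow> quat \<times> quat \<Rightarrow> quat \<times> quat" where
  "Fabc a b c x = (qmul (qmul a (fst x)) (qcnj c), qmul (qmul b (snd x)) (qcnj c))"

definition f_r :: "real \<Rightarrow> quat \<times> quat \<Rightarrow> quat \<times> quat" where
  "f_r r x = (fst x, qreal (sqrt (1 - r^2)) + r *\<^sub>R snd x)"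

end

theory Submission
  imports Defs
begin

text \<open>Write a tangent vector at \<open>(p, q)\<close> as \<open>(p (a + c), q (a - c))\<close> with imaginary \<open>a\<close>, \<open>c\<close>. The condition
  \<open>P \<xi> = - \<xi>\<close> says \<open>\<xi> = (p u, - q u)\<close>, so \<open>M\<close> contains the directions \<open>c = 0\<close> tangent to the fibres of
  \<open>(p, q) \<mapsto> q p\<^sup>-\<^sup>1\<close> and lies over a surface \<open>\<Sigma>\<close> in the three-sphere. In this splitting the shape operator is
  \<open>(a, c) \<mapsto> (- c \<times> u, T c + a \<times> u / 3)\<close>, where \<open>T\<close> is essentially the shape operator of \<open>\<Sigma>\<close>. An eigenvalue
  \<open>s\<close> of \<open>T\<close> contributes the two roots of \<open>\<lambda>\<^sup>2 - s \<lambda> = 1/12\<close> as principal curvatures, so there are only three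
  of them just when \<open>T\<close> is a multiple of the identity. Hence \<open>\<Sigma>\<close> is umbilic, that is, an open part of a round
  sphere \<open>{w. m \<bullet> w = k}\<close>, and left multiplication of \<open>q\<close> by the conjugate of \<open>m\<close> moves it to the sphere of
  quaternions with real part \<open>k\<close>.\<close>

section \<open>Quaternions and the nearly Kaehler metric in a left-invariant frame\<close>

text \<open>The obstacle is that \<open>M\<close> is only a local zero set, with
  \<open>\<xi>\<close> known along \<open>M\<close> alone: neither the fibres inside
  \<open>M\<close> nor the surface \<Sigma> is given in advance. The shape operator is therefore
  computed from integrability. Brackets of tangent fields are tangent to \<open>M\<close>, which
  fixes the derivative of \<open>u\<close> in the fibre directions and makes \<open>T\<close>
  symmetric. The constant 1/12 is |u|^2/3, where |u| = 1/2 because \<xi> has unit length for the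
  metric. The two roots have product -1/12, so no root is 0, and a root \<lambda> determines s =
  \<lambda> - 1/(12 \<lambda>); hence distinct eigenvalues of \<open>T\<close> have no curvature in
  common. Umbilicity says dN = s dw for the normal N of \<Sigma> at w. Once s is locally constant, N
  - s w is a fixed vector k0, and k0 . w = -s is the equation of the sphere. This only places
  \<open>M\<close> inside the preimage of a sphere; invariance of domain turns the inclusion into
  openness.\<close>

lemma bounded_bilinear_qmul: "bounded_bilinear qmul"
proof -
  have "bilinear qmul"
    unfolding bilinear_def
    by (auto intro!: linearI simp: qmul_def vec_eq_iff forall_4 algebra_simps)
  then show ?thesis by (simp add: bilinear_conv_bounded_bilinear)
qed

interpretation qmul: bounded_bilinear qmul by (rule bounded_bilinear_qmul)

lemma bounded_linear_qcnj: "bounded_linear qcnj"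
  by (auto intro!: linearI simp: linear_conv_bounded_linear[symmetric] qcnj_def vec_eq_iff algebra_simps)

lemmas has_derivative_qcnj [derivative_intros] = bounded_linear.has_derivative[OF bounded_linear_qcnj]

lemma qmul_assoc: "qmul (qmul x y) z = qmul x (qmul y z)"
  by (simp add: qmul_def vec_eq_iff forall_4 algebra_simps)

lemma qmul_qreal [simp]: "qmul (qreal r) x = r *\<^sub>R x" "qmul x (qreal r) = r *\<^sub>R x"
  by (simp_all add: qmul_def qreal_def vec_eq_iff forall_4)

lemma qcnj_qmul: "qcnj (qmul x y) = qmul (qcnj y) (qcnj x)"
  by (simp add: qmul_def qcnj_def vec_eq_iff forall_4 algebra_simps)

lemma qcnj_qcnj [simp]: "qcnj (qcnj x) = x"
  by (simp add: qcnj_def vec_eq_iff)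

lemma qcnj_qreal [simp]: "qcnj (qreal r) = qreal r"
  by (simp add: qcnj_def qreal_def vec_eq_iff)

lemma qcnj_imag: "x $ 1 = 0 \<Longrightarrow> qcnj x = - x"
  by (simp add: qcnj_def vec_eq_iff)

lemma inner_quat: "(x::quat) \<bullet> y = x$1*y$1 + x$2*y$2 + x$3*y$3 + x$4*y$4"
  by (simp add: inner_vec_def sum_4)

lemma qmul_qcnj: "qmul x (qcnj x) = qreal (x \<bullet> x)" "qmul (qcnj x) x = qreal (x \<bullet> x)"
  by (simp_all add: qmul_def qcnj_def qreal_def inner_quat vec_eq_iff forall_4 algebra_simps)

lemma inner_qmul_left: "qmul p x \<bullet> y = x \<bullet> qmul (qcnj p) y"
  by (simp add: qmul_def qcnj_def inner_quat algebra_simps)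

lemma inner_qmul_right: "qmul x p \<bullet> y = x \<bullet> qmul y (qcnj p)"
  by (simp add: qmul_def qcnj_def inner_quat algebra_simps)

lemma inner_qcnj [simp]: "qcnj x \<bullet> qcnj y = x \<bullet> y"
  by (simp add: qcnj_def inner_quat)

lemma norm_qcnj [simp]: "norm (qcnj x) = norm x"
  by (simp add: norm_eq_sqrt_inner)

lemma norm_qmul: "norm (qmul x y) = norm x * norm y"
proof -
  have "qmul x y \<bullet> qmul x y = (x \<bullet> x) * (y \<bullet> y)"
    by (simp add: inner_qmul_left qmul_assoc[symmetric] qmul_qcnj)
  then show ?thesis
    by (simp add: norm_eq_sqrt_inner real_sqrt_mult)
qed

lemma qmul_component1: "qmul x y $ 1 = qcnj x \<bullet> y"
  by (simp add: qmul_def qcnj_def inner_quat)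

lemma qreal_component1 [simp]: "qreal r $ 1 = r"
  by (simp add: qreal_def)

lemma S3_inner: "p \<in> S3 \<longleftrightarrow> p \<bullet> p = 1"
  by (simp add: S3_def norm_eq_1)

lemma S3_cancel:
  assumes "p \<in> S3"
  shows "qmul p (qmul (qcnj p) x) = x" "qmul (qcnj p) (qmul p x) = x"
    "qmul (qmul x p) (qcnj p) = x" "qmul (qmul x (qcnj p)) p = x"
    "qmul p (qcnj p) = qreal 1" "qmul (qcnj p) p = qreal 1"
    "qinv p = qcnj p"
  using assms
  by (simp_all add: S3_inner qmul_qcnj qmul_assoc)
    (simp_all add: qmul_assoc[symmetric] qmul_qcnj qinv_def power2_norm_eq_inner)

lemma qcnj_S3: "p \<in> S3 \<Longrightarrow> qcnj p \<in> S3"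
  by (simp add: S3_def)

lemma qmul_S3: "p \<in> S3 \<Longrightarrow> q \<in> S3 \<Longrightarrow> qmul p q \<in> S3"
  by (simp add: S3_def norm_qmul)

lemma inner_qmul_left_S3: "p \<in> S3 \<Longrightarrow> qmul p x \<bullet> qmul p y = x \<bullet> y"
  by (simp add: inner_qmul_left S3_cancel)

lemma inner_qmul_right_S3: "p \<in> S3 \<Longrightarrow> qmul x p \<bullet> qmul y p = x \<bullet> y"
  by (simp add: inner_qmul_right S3_cancel)

section \<open>Left-invariant coordinates on the tangent spaces\<close>

definition qcross :: "quat \<Rightarrow> quat \<Rightarrow> quat" where
  "qcross x y = (1/2) *\<^sub>R (qmul x y - qmul y x)"

text \<open>The left trivialisation of the tangent bundle. In these coordinates the metric has
  constant coefficients and P swaps \<alpha> and \<beta>, so the base point drops out of the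
  computations.\<close>

definition lframe :: "quat \<times> quat \<Rightarrow> quat \<Rightarrow> quat \<Rightarrow> quat \<times> quat" where
  "lframe x \<alpha> \<beta> = (qmul (fst x) \<alpha>, qmul (snd x) \<beta>)"

lemma NK_S3: "x \<in> NK \<Longrightarrow> fst x \<in> S3" "x \<in> NK \<Longrightarrow> snd x \<in> S3"
  by (auto simp: NK_def)

lemma lframe_eq_iff:
  assumes "x \<in> NK"
  shows "lframe x \<alpha> \<beta> = Z \<longleftrightarrow> \<alpha> = qmul (qcnj (fst x)) (fst Z) \<and> \<beta> = qmul (qcnj (snd x)) (snd Z)"
  using NK_S3[OF assms] by (cases Z) (auto simp: lframe_def S3_cancel)

lemma lframe_inject:
  "x \<in> NK \<Longrightarrow> lframe x \<alpha> \<beta> = lframe x \<alpha>' \<beta>' \<longleftrightarrow> \<alpha> = \<alpha>' \<and> \<beta> = \<beta>'"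
  by (auto simp: lframe_eq_iff) (simp_all add: lframe_def S3_cancel NK_S3)

lemma lframe_TN: "x \<in> NK \<Longrightarrow> lframe x \<alpha> \<beta> \<in> TN x \<longleftrightarrow> \<alpha> $ 1 = 0 \<and> \<beta> $ 1 = 0"
proof -
  have "p \<bullet> qmul p \<alpha> = (p \<bullet> p) * \<alpha> $ 1" for p \<alpha>
    by (simp add: inner_quat qmul_def algebra_simps)
  then show "x \<in> NK \<Longrightarrow> ?thesis" by (simp add: TN_def lframe_def NK_S3 S3_inner[THEN iffD1])
qed

lemma lframe_scaleR: "k *\<^sub>R lframe x \<alpha> \<beta> = lframe x (k *\<^sub>R \<alpha>) (k *\<^sub>R \<beta>)"
  by (simp add: lframe_def qmul.scaleR_right)

lemma lframe_minus: "- lframe x \<alpha> \<beta> = lframe x (- \<alpha>) (- \<beta>)"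
  by (simp add: lframe_def qmul.minus_right)

lemma lframe_diff: "lframe x \<alpha> \<beta> - lframe x \<alpha>' \<beta>' = lframe x (\<alpha> - \<alpha>') (\<beta> - \<beta>')"
  by (simp add: lframe_def qmul.diff_right)

lemma lframe_0: "lframe x 0 0 = 0"
  by (simp add: lframe_def qmul.zero_right zero_prod_def)

lemma lframe_exhaust:
  assumes "x \<in> NK" "Z \<in> TN x"
  obtains \<alpha> \<beta> where "Z = lframe x \<alpha> \<beta>" "\<alpha> $ 1 = 0" "\<beta> $ 1 = 0"
  using assms lframe_TN lframe_eq_iff by metis

lemma gNK_lframe:
  assumes "x \<in> NK"
  shows "gNK x (lframe x \<alpha> \<beta>) (lframe x \<alpha>' \<beta>') =
    4/3 * (\<alpha> \<bullet> \<alpha>' + \<beta> \<bullet> \<beta>') - 2/3 * (\<alpha> \<bullet> \<beta>' + \<alpha>' \<bullet> \<beta>)"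
  using NK_S3[OF assms] by (simp add: gNK_def lframe_def S3_cancel inner_qmul_left_S3)

text \<open>Up to the factor 2/3 the form is |\<alpha>|^2 + |\<beta>|^2 + |\<alpha> - \<beta>|^2.
  Definiteness supplies the uniqueness on which the \<open>THE\<close> in \<open>nablaNK\<close>
  depends.\<close>

lemma gNK_definite:
  assumes "x \<in> NK" "gNK x Z Z = 0" shows "Z = 0"
proof -
  obtain \<alpha> \<beta> where Z: "Z = lframe x \<alpha> \<beta>" by (metis lframe_eq_iff[OF assms(1)])
  have "\<alpha> \<bullet> \<alpha> + \<beta> \<bullet> \<beta> + (\<alpha> - \<beta>) \<bullet> (\<alpha> - \<beta>) = 0"
    using assms(2) unfolding Z gNK_lframe[OF assms(1)] by (simp add: algebra_simps inner_commute)
  then have "\<alpha> \<bullet> \<alpha> = 0" "\<beta> \<bullet> \<beta> = 0"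
    using inner_ge_zero[of \<alpha>] inner_ge_zero[of \<beta>] inner_ge_zero[of "\<alpha> - \<beta>"] by linarith+
  then show ?thesis by (simp add: Z lframe_0)
qed

section \<open>The Levi-Civita connection in left-invariant coordinates\<close>

lemma has_derivative_qinv:
  assumes "p \<in> S3"
  shows "(qinv has_derivative (\<lambda>h. qcnj h - (2 * (p \<bullet> h)) *\<^sub>R qcnj p)) (at p)"
proof -
  have [simp]: "p \<noteq> 0" "p \<bullet> p = 1" using assms by (auto simp: S3_inner)
  have e: "qinv = (\<lambda>p. inverse (p \<bullet> p) *\<^sub>R qcnj p)"
    by (simp add: qinv_def fun_eq_iff power2_norm_eq_inner inverse_eq_divide)
  show ?thesis unfolding e
    by (auto intro!: derivative_eq_intros simp: fun_eq_iff inner_commute algebra_simps)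
qed

text \<open>The base point enters the metric only through the two inverses. In a tangent direction
  the radial term in the derivative of \<open>qinv\<close> vanishes, so only the conjugates of the
  components of \<open>X\<close> remain.\<close>

lemma dgNK_tangent:
  assumes x: "x \<in> NK" and X: "X \<in> TN x"
  shows "dgNK x X Y Z = - 2/3 *
    ((qmul (qcnj (fst X)) (fst Y)) \<bullet> (qmul (qcnj (snd x)) (snd Z))
    + (qmul (qcnj (fst x)) (fst Y)) \<bullet> (qmul (qcnj (snd X)) (snd Z))
    + (qmul (qcnj (fst X)) (fst Z)) \<bullet> (qmul (qcnj (snd x)) (snd Y))
    + (qmul (qcnj (fst x)) (fst Z)) \<bullet> (qmul (qcnj (snd X)) (snd Y)))"
proof -
  note S = NK_S3[OF x]
  have 1: "((\<lambda>y. qinv (fst y)) has_derivative (\<lambda>h. qcnj (fst h) - (2 * (fst x \<bullet> fst h)) *\<^sub>R qcnj (fst x))) (at x)"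
    by (rule has_derivative_compose[OF bounded_linear_imp_has_derivative[OF bounded_linear_fst] has_derivative_qinv[OF S(1)]])
  have 2: "((\<lambda>y. qinv (snd y)) has_derivative (\<lambda>h. qcnj (snd h) - (2 * (snd x \<bullet> snd h)) *\<^sub>R qcnj (snd x))) (at x)"
    by (rule has_derivative_compose[OF bounded_linear_imp_has_derivative[OF bounded_linear_snd] has_derivative_qinv[OF S(2)]])
  have 3: "((\<lambda>y. qmul (qinv (fst y)) w) has_derivative
      (\<lambda>h. qmul (qcnj (fst h) - (2 * (fst x \<bullet> fst h)) *\<^sub>R qcnj (fst x)) w)) (at x)" for w
    by (rule bounded_linear.has_derivative[OF qmul.bounded_linear_left 1])
  have 4: "((\<lambda>y. qmul (qinv (snd y)) w) has_derivative
      (\<lambda>h. qmul (qcnj (snd h) - (2 * (snd x \<bullet> snd h)) *\<^sub>R qcnj (snd x)) w)) (at x)" for w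
    by (rule bounded_linear.has_derivative[OF qmul.bounded_linear_left 2])
  have X': "fst x \<bullet> fst X = 0" "snd x \<bullet> snd X = 0" using X by (auto simp: TN_def)
  have "((\<lambda>y. gNK y Y Z) has_derivative (\<lambda>h. - 2/3 *
    ((qmul (qcnj (fst h) - (2 * (fst x \<bullet> fst h)) *\<^sub>R qcnj (fst x)) (fst Y)) \<bullet> (qmul (qinv (snd x)) (snd Z))
    + (qmul (qinv (fst x)) (fst Y)) \<bullet> (qmul (qcnj (snd h) - (2 * (snd x \<bullet> snd h)) *\<^sub>R qcnj (snd x)) (snd Z))
    + (qmul (qcnj (fst h) - (2 * (fst x \<bullet> fst h)) *\<^sub>R qcnj (fst x)) (fst Z)) \<bullet> (qmul (qinv (snd x)) (snd Y))
    + (qmul (qinv (fst x)) (fst Z)) \<bullet> (qmul (qcnj (snd h) - (2 * (snd x \<bullet> snd h)) *\<^sub>R qcnj (snd x)) (snd Y))))) (at x)"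
    unfolding gNK_def by (rule derivative_eq_intros 3 4 refl | simp add: fun_eq_iff)+
  from frechet_derivative_at[OF this, symmetric]
  show ?thesis unfolding dgNK_def by (simp add: X' S3_cancel S)
qed

lemma dgNK_lframe:
  assumes "x \<in> NK" "\<alpha> $ 1 = 0" "\<beta> $ 1 = 0"
  shows "dgNK x (lframe x \<alpha> \<beta>) (lframe x \<alpha>' \<beta>') (lframe x \<alpha>'' \<beta>'') =
    2/3 * (qmul \<alpha> \<alpha>' \<bullet> \<beta>'' + \<alpha>' \<bullet> qmul \<beta> \<beta>'' + qmul \<alpha> \<alpha>'' \<bullet> \<beta>' + \<alpha>'' \<bullet> qmul \<beta> \<beta>')"
proof -
  have T: "lframe x \<alpha> \<beta> \<in> TN x" using assms by (simp add: lframe_TN)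
  show ?thesis
    unfolding dgNK_tangent[OF assms(1) T] using NK_S3[OF assms(1)] assms(2,3)
    by (simp add: lframe_def qcnj_qmul qmul_assoc S3_cancel qcnj_imag qmul.minus_left field_simps)
qed

text \<open>Two solutions of the Koszul identities differ by a tangent vector that is orthogonal to
  itself.\<close>

lemma nablaNK_eqI:
  assumes x: "x \<in> NK" and W: "W \<in> TN x"
    and *: "\<And>Z. Z \<in> TN x \<Longrightarrow> gNK x W Z = gNK x DY Z + 1/2 * (dgNK x X Y Z + dgNK x Y X Z - dgNK x Z X Y)"
  shows "nablaNK x X Y DY = W"
  unfolding nablaNK_def
proof (rule the_equality)
  fix W' assume W': "W' \<in> TN x \<and> (\<forall>Z\<in>TN x. gNK x W' Z = gNK x DY Z + 1/2 * (dgNK x X Y Z + dgNK x Y X Z - dgNK x Z X Y))"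
  have T: "W' - W \<in> TN x" using W W' by (simp add: TN_def inner_diff_right)
  have "gNK x (W' - W) (W' - W) = gNK x W' (W' - W) - gNK x W (W' - W)"
    by (simp add: gNK_def inner_diff_left inner_diff_right qmul.diff_right algebra_simps)
  also have "\<dots> = 0" using * W' T by simp
  finally show "W' = W" using gNK_definite[OF x] by fastforce
qed (use W * in blast)

text \<open>The splitting \<open>(a + c, a - c)\<close> is orthogonal for the metric: it separates the fibres of
  \<open>(p, q) \<mapsto> q p\<^sup>-\<^sup>1\<close> from their orthogonal complements.\<close>

lemma nablaNK_lframe:
  assumes x: "x \<in> NK" and "u $ 1 = 0" "a $ 1 = 0" "c $ 1 = 0" "\<gamma> $ 1 = 0"
  shows "nablaNK x (lframe x (a + c) (a - c)) (lframe x u (- u))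
      (lframe x (qmul (a + c) u + \<gamma>) (- (qmul (a - c) u + \<gamma>))) =
    lframe x (qcross c u + (\<gamma> + (5/3) *\<^sub>R qcross a u)) (qcross c u - (\<gamma> + (5/3) *\<^sub>R qcross a u))"
\<comment> \<open>The last argument of \<open>nablaNK\<close> is the ambient derivative of the field
  (p u, - q u) in the given direction, with \<gamma> the rate of change of u.\<close>
proof (rule nablaNK_eqI[OF x])
  have [simp]: "qcross y z $ 1 = 0" for y z
    by (simp add: qcross_def qmul_def)
  show "lframe x (qcross c u + (\<gamma> + (5/3) *\<^sub>R qcross a u)) (qcross c u - (\<gamma> + (5/3) *\<^sub>R qcross a u)) \<in> TN x"
    using assms by (simp add: lframe_TN)
  fix Z assume "Z \<in> TN x"
  then obtain \<alpha> \<beta> where Z: "Z = lframe x \<alpha> \<beta>" "\<alpha> $ 1 = 0" "\<beta> $ 1 = 0"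
    using lframe_exhaust x by blast
  show "gNK x (lframe x (qcross c u + (\<gamma> + (5/3) *\<^sub>R qcross a u)) (qcross c u - (\<gamma> + (5/3) *\<^sub>R qcross a u))) Z =
    gNK x (lframe x (qmul (a + c) u + \<gamma>) (- (qmul (a - c) u + \<gamma>))) Z +
    1/2 * (dgNK x (lframe x (a + c) (a - c)) (lframe x u (- u)) Z + dgNK x (lframe x u (- u)) (lframe x (a + c) (a - c)) Z -
      dgNK x Z (lframe x (a + c) (a - c)) (lframe x u (- u)))"
    \<comment> \<open>In the frame the Koszul identity becomes a polynomial identity between the
      components of imaginary quaternions.\<close>
    unfolding Z using assms Z(2,3)
    by (simp add: gNK_lframe dgNK_lframe) (simp add: inner_quat qcross_def qmul_def field_simps)
qed

section \<open>Smooth maps, submersions and level sets\<close>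

lemma smooth_on_has_derivative:
  assumes "smooth_on S f" "x \<in> S"
  shows "(f has_derivative frechet_derivative f (at x)) (at x)"
proof -
  have "f differentiable_on S" using assms(1) unfolding smooth_on_def by (metis iter_dderiv.simps(1))
  then show ?thesis
    using assms by (simp add: smooth_on_def differentiable_on_eq_differentiable_at frechet_derivative_works[symmetric])
qed

lemma smooth_on_dderiv:
  assumes "smooth_on S f"
  shows "smooth_on S (\<lambda>x. frechet_derivative f (at x) v)"
proof -
  have "iter_dderiv vs (\<lambda>x. frechet_derivative f (at x) v) = iter_dderiv (vs @ [v]) f" for vs
    by (induction vs) auto
  then show ?thesis using assms by (simp add: smooth_on_def)
qed

lemma smooth_on_continuous_on: "smooth_on S f \<Longrightarrow> continuous_on S f"
  unfolding smooth_on_def using differentiable_imp_continuous_on iter_dderiv.simps(1) by metis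

text \<open>Smoothness is phrased with directional derivatives, whereas the inverse function theorem
  asks for a derivative continuous in operator norm. In finite dimension continuity in each
  direction is enough.\<close>

lemma smooth_on_blinfun_derivative:
  fixes f :: "'a::euclidean_space \<Rightarrow> 'b::real_normed_vector"
  assumes "smooth_on S f"
  obtains f' where "\<And>x. x \<in> S \<Longrightarrow> (f has_derivative blinfun_apply (f' x)) (at x)"
    "continuous_on S f'"
    "\<And>x. x \<in> S \<Longrightarrow> blinfun_apply (f' x) = frechet_derivative f (at x)"
proof -
  define f' where "f' x = Blinfun (frechet_derivative f (at x))" for x
  have *: "blinfun_apply (f' x) = frechet_derivative f (at x)" if "x \<in> S" for x
    using smooth_on_has_derivative[OF assms that]
    by (simp add: f'_def bounded_linear_Blinfun_apply has_derivative_bounded_linear)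
  have "continuous_on S (\<lambda>x. blinfun_apply (f' x) v)" for v
    using smooth_on_continuous_on[OF smooth_on_dderiv[OF assms, of v]] *
    by (simp cong: continuous_on_cong)
  then have "continuous_on S f'" by (intro continuous_on_blinfun_componentwise)
  then show ?thesis using that * smooth_on_has_derivative[OF assms] by metis
qed

section \<open>Symmetry of second derivatives\<close>

lemma mixed_derivative_MVT:
  fixes f :: "'a::real_normed_vector \<Rightarrow> real"
  assumes S: "\<And>s r. 0 \<le> s \<Longrightarrow> s \<le> t \<Longrightarrow> 0 \<le> r \<Longrightarrow> r \<le> t \<Longrightarrow> x + s *\<^sub>R u + r *\<^sub>R v \<in> S" and t: "0 < t"
    and f: "\<And>y. y \<in> S \<Longrightarrow> (f has_derivative f' y) (at y)"
    and f'': "\<And>y. y \<in> S \<Longrightarrow> ((\<lambda>y. f' y u) has_derivative f'' y) (at y)"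
  shows "\<exists>s r. 0 \<le> s \<and> s \<le> t \<and> 0 \<le> r \<and> r \<le> t \<and>
    f (x + t *\<^sub>R u + t *\<^sub>R v) - f (x + t *\<^sub>R u) - f (x + t *\<^sub>R v) + f x = t * (t * f'' (x + s *\<^sub>R u + r *\<^sub>R v) v)"
proof -
  \<comment> \<open>The vanishing summand \<open>0 *\<^sub>R v\<close> is kept so that both terms
    are instances of \<open>line\<close>, with \<open>r = t\<close> and
    \<open>r = 0\<close>.\<close>
  define \<phi> where "\<phi> s = f (x + s *\<^sub>R u + t *\<^sub>R v) - f (x + s *\<^sub>R u + 0 *\<^sub>R v)" for s
  have line: "((\<lambda>s. f (x + s *\<^sub>R u + r *\<^sub>R v)) has_derivative (\<lambda>h. f' (x + s *\<^sub>R u + r *\<^sub>R v) (h *\<^sub>R u))) (at s)"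
    if "0 \<le> s" "s \<le> t" "0 \<le> r" "r \<le> t" for s r
    by (rule has_derivative_compose[where f = "\<lambda>s. x + s *\<^sub>R u + r *\<^sub>R v" and g = f, OF _ f[OF S[OF that]]])
      (auto intro!: derivative_eq_intros)
  have "\<exists>s. 0 < s \<and> s < t \<and> \<phi> t - \<phi> 0 = (t - 0) * (f' (x + s *\<^sub>R u + t *\<^sub>R v) u - f' (x + s *\<^sub>R u + 0 *\<^sub>R v) u)"
  proof (rule MVT2[OF t])
    fix s assume s: "0 \<le> s" "s \<le> t"
    have lin: "linear (f' (x + s *\<^sub>R u + r *\<^sub>R v))" if "0 \<le> r" "r \<le> t" for r
      using f[OF S[OF s that]] by (rule has_derivative_linear)
    have D: "(\<phi> has_derivative (\<lambda>h. f' (x + s *\<^sub>R u + t *\<^sub>R v) (h *\<^sub>R u) - f' (x + s *\<^sub>R u + 0 *\<^sub>R v) (h *\<^sub>R u))) (at s)"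
      unfolding \<phi>_def using s t by (intro has_derivative_diff line) auto
    have e: "f' (x + s *\<^sub>R u + r *\<^sub>R v) (h *\<^sub>R u) = h * f' (x + s *\<^sub>R u + r *\<^sub>R v) u"
      if "0 \<le> r" "r \<le> t" for r h
      using linear_scale[OF lin[OF that]] by simp
    show "DERIV \<phi> s :> f' (x + s *\<^sub>R u + t *\<^sub>R v) u - f' (x + s *\<^sub>R u + 0 *\<^sub>R v) u"
      by (rule has_derivative_imp_has_field_derivative[OF D])
        (use e[of t] e[of 0] t in \<open>simp add: right_diff_distrib\<close>)
  qed
  then obtain s where s: "0 < s" "s < t" and e1:
    "\<phi> t - \<phi> 0 = t * (f' (x + s *\<^sub>R u + t *\<^sub>R v) u - f' (x + s *\<^sub>R u + 0 *\<^sub>R v) u)" by auto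
  have "\<exists>r. 0 < r \<and> r < t \<and> f' (x + s *\<^sub>R u + t *\<^sub>R v) u - f' (x + s *\<^sub>R u + 0 *\<^sub>R v) u
      = (t - 0) * f'' (x + s *\<^sub>R u + r *\<^sub>R v) v"
  proof (rule MVT2[OF t])
    fix r assume r: "0 \<le> r" "r \<le> t"
    have D: "((\<lambda>r. f' (x + s *\<^sub>R u + r *\<^sub>R v) u) has_derivative (\<lambda>h. f'' (x + s *\<^sub>R u + r *\<^sub>R v) (h *\<^sub>R v))) (at r)"
      by (rule has_derivative_compose[where f = "\<lambda>r. x + s *\<^sub>R u + r *\<^sub>R v", OF _ f''[OF S]])
        (use s r in \<open>auto intro!: derivative_eq_intros\<close>)
    have "linear (f'' (x + s *\<^sub>R u + r *\<^sub>R v))"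
      using s r by (intro has_derivative_linear[OF f''[OF S]]) auto
    then show "DERIV (\<lambda>r. f' (x + s *\<^sub>R u + r *\<^sub>R v) u) r :> f'' (x + s *\<^sub>R u + r *\<^sub>R v) v"
      by (intro has_derivative_imp_has_field_derivative[OF D]) (simp add: linear_scale)
  qed
  then obtain r where r: "0 < r" "r < t" and e2: "f' (x + s *\<^sub>R u + t *\<^sub>R v) u - f' (x + s *\<^sub>R u + 0 *\<^sub>R v) u
      = t * f'' (x + s *\<^sub>R u + r *\<^sub>R v) v" by auto
  show ?thesis
    using s r e1 unfolding e2 by (intro exI[of _ s] exI[of _ r]) (auto simp: \<phi>_def)
qed

text \<open>The second difference over a small parallelogram does not depend on the order of
  \<open>u\<close> and \<open>v\<close>. Applying the mean value theorem twice in either order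
  writes it as t^2 times a value of \<open>fu\<close> or of \<open>fv\<close> close to
  \<open>x\<close>; by continuity the two limits agree.\<close>

lemma symmetric_second_derivative_real:
  fixes f :: "'a::real_normed_vector \<Rightarrow> real"
  assumes S: "open S" "x \<in> S"
    and f: "\<And>y. y \<in> S \<Longrightarrow> (f has_derivative f' y) (at y)"
    and fu: "\<And>y. y \<in> S \<Longrightarrow> ((\<lambda>y. f' y u) has_derivative fu y) (at y)"
    and fv: "\<And>y. y \<in> S \<Longrightarrow> ((\<lambda>y. f' y v) has_derivative fv y) (at y)"
    and cont: "continuous (at x) (\<lambda>y. fu y v)" "continuous (at x) (\<lambda>y. fv y u)"
  shows "fu x v = fv x u"
proof (rule ccontr)
  define e where "e = \<bar>fu x v - fv x u\<bar> / 2"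
  assume "fu x v \<noteq> fv x u"
  then have e: "e > 0" by (simp add: e_def)
  obtain d0 where d0: "d0 > 0" "ball x d0 \<subseteq> S" using S openE by blast
  obtain d1 where d1: "d1 > 0" "\<And>y. dist y x < d1 \<Longrightarrow> \<bar>fu y v - fu x v\<bar> < e"
    using cont(1) e unfolding continuous_at_eps_delta by (auto simp: dist_real_def)
  obtain d2 where d2: "d2 > 0" "\<And>y. dist y x < d2 \<Longrightarrow> \<bar>fv y u - fv x u\<bar> < e"
    using cont(2) e unfolding continuous_at_eps_delta by (auto simp: dist_real_def)
  define d where "d = min d0 (min d1 d2)"
  have d: "d > 0" "d \<le> d0" "d \<le> d1" "d \<le> d2" using d0 d1 d2 by (auto simp: d_def)
  \<comment> \<open>The summand 1 keeps \<open>n\<close> positive when both directions are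
    zero.\<close>
  define n where "n = norm u + norm v + 1"
  have n: "n > 0" "norm u + norm v < n" by (auto simp: n_def add_nonneg_pos)
  define t where "t = d / (2 * n)"
  have t: "t > 0" using d n by (simp add: t_def)
  have near: "dist (x + s *\<^sub>R u + r *\<^sub>R v) x < d" if "0 \<le> s" "s \<le> t" "0 \<le> r" "r \<le> t" for s r
  proof -
    have "dist (x + s *\<^sub>R u + r *\<^sub>R v) x = norm (s *\<^sub>R u + r *\<^sub>R v)" by (simp add: dist_norm add.assoc)
    also have "\<dots> \<le> s * norm u + r * norm v" using norm_triangle_ineq[of "s *\<^sub>R u" "r *\<^sub>R v"] that by simp
    also have "\<dots> \<le> t * norm u + t * norm v" by (intro add_mono mult_right_mono) (use that in auto)
    also have "\<dots> = t * (norm u + norm v)" by (simp add: distrib_left)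
    also have "\<dots> < t * n" using n t by simp
    also have "\<dots> < d" using n d by (simp add: t_def field_simps)
    finally show ?thesis .
  qed
  have "\<exists>s r. 0 \<le> s \<and> s \<le> t \<and> 0 \<le> r \<and> r \<le> t \<and>
    f (x + t *\<^sub>R u + t *\<^sub>R v) - f (x + t *\<^sub>R u) - f (x + t *\<^sub>R v) + f x = t * (t * fu (x + s *\<^sub>R u + r *\<^sub>R v) v)"
    by (rule mixed_derivative_MVT[where S = "ball x d" and f' = f'])
      (use t near f fu d0 d in \<open>auto simp: dist_commute subset_iff\<close>)
  then obtain s r where sr: "0 \<le> s" "s \<le> t" "0 \<le> r" "r \<le> t" and E1:
    "f (x + t *\<^sub>R u + t *\<^sub>R v) - f (x + t *\<^sub>R u) - f (x + t *\<^sub>R v) + f x = t * (t * fu (x + s *\<^sub>R u + r *\<^sub>R v) v)"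
    by blast
  have "\<exists>s r. 0 \<le> s \<and> s \<le> t \<and> 0 \<le> r \<and> r \<le> t \<and>
    f (x + t *\<^sub>R v + t *\<^sub>R u) - f (x + t *\<^sub>R v) - f (x + t *\<^sub>R u) + f x = t * (t * fv (x + s *\<^sub>R v + r *\<^sub>R u) u)"
    by (rule mixed_derivative_MVT[where S = "ball x d" and f' = f'])
      (use t near f fv d0 d in \<open>auto simp: dist_commute subset_iff add.assoc add.commute[of "_ *\<^sub>R v"]\<close>)
  then obtain s' r' where sr': "0 \<le> s'" "s' \<le> t" "0 \<le> r'" "r' \<le> t" and E2:
    "f (x + t *\<^sub>R v + t *\<^sub>R u) - f (x + t *\<^sub>R v) - f (x + t *\<^sub>R u) + f x = t * (t * fv (x + s' *\<^sub>R v + r' *\<^sub>R u) u)"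
    by blast
  have "x + t *\<^sub>R v + t *\<^sub>R u = x + t *\<^sub>R u + t *\<^sub>R v" "x + s' *\<^sub>R v + r' *\<^sub>R u = x + r' *\<^sub>R u + s' *\<^sub>R v"
    by simp_all
  with E1 E2 have "t * (t * fu (x + s *\<^sub>R u + r *\<^sub>R v) v) = t * (t * fv (x + r' *\<^sub>R u + s' *\<^sub>R v) u)"
    by (simp add: algebra_simps)
  then have "fu (x + s *\<^sub>R u + r *\<^sub>R v) v = fv (x + r' *\<^sub>R u + s' *\<^sub>R v) u" using t by simp
  moreover have "\<bar>fu (x + s *\<^sub>R u + r *\<^sub>R v) v - fu x v\<bar> < e"
    using near[OF sr] d by (intro d1(2)) auto
  moreover have "\<bar>fv (x + r' *\<^sub>R u + s' *\<^sub>R v) u - fv x u\<bar> < e"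
    using near[of r' s'] sr' d by (intro d2(2)) auto
  ultimately show False unfolding e_def by argo
qed

lemma symmetric_second_derivative:
  fixes f :: "'a::euclidean_space \<Rightarrow> 'b::euclidean_space"
  assumes f: "smooth_on S f" and x: "x \<in> S"
  shows "frechet_derivative (\<lambda>y. frechet_derivative f (at y) u) (at x) v =
    frechet_derivative (\<lambda>y. frechet_derivative f (at y) v) (at x) u"
proof (rule euclidean_eqI)
  fix b :: 'b assume "b \<in> Basis"
  have S: "open S" using f by (simp add: smooth_on_def)
  note D = smooth_on_has_derivative[OF f] and D2 = smooth_on_has_derivative[OF smooth_on_dderiv[OF f]]
  have c: "continuous (at x) (\<lambda>y. frechet_derivative (\<lambda>y. frechet_derivative f (at y) u) (at y) v \<bullet> b)" for u v
    using smooth_on_continuous_on[OF smooth_on_dderiv[OF smooth_on_dderiv[OF f]]] S x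
    by (intro continuous_intros) (simp add: continuous_on_eq_continuous_at)
  show "frechet_derivative (\<lambda>y. frechet_derivative f (at y) u) (at x) v \<bullet> b =
    frechet_derivative (\<lambda>y. frechet_derivative f (at y) v) (at x) u \<bullet> b"
    by (rule symmetric_second_derivative_real[OF S x, of "\<lambda>y. f y \<bullet> b" "\<lambda>y h. frechet_derivative f (at y) h \<bullet> b"])
      (auto intro!: has_derivative_inner_left D D2 c)
qed

text \<open>The chart replaces the component of y along the range of the right inverse
  \<open>B\<close> by B (H y), that is, \<Phi> y = y - B (H' x y) + B (H y). Its derivative at
  \<open>x\<close> is the identity, and it carries level sets of \<open>H\<close> into level sets of
  the linear map \<open>H' x\<close>.\<close>

lemma submersion_chart:
  fixes H :: "'a::euclidean_space \<Rightarrow> 'b::euclidean_space"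
  assumes S: "open S" "x \<in> S" and H: "\<And>y. y \<in> S \<Longrightarrow> (H has_derivative blinfun_apply (H' y)) (at y)"
    and cont: "continuous_on S H'" and B: "linear B" "\<And>z. H' x (B z) = z"
  obtains U V \<Phi> g g' where "open U" "x \<in> U" "U \<subseteq> S" "open V" "homeomorphism U V \<Phi> g"
    "\<And>y. y \<in> U \<Longrightarrow> H' x (\<Phi> y) = H y" "\<And>z. z \<in> V \<Longrightarrow> (g has_derivative g' z) (at z)"
    "g' (\<Phi> x) = id"
proof -
  have BB: "bounded_linear B" using B(1) by (simp add: linear_conv_bounded_linear)
  define \<Phi> where "\<Phi> y = y - B (H' x y) + B (H y)" for y
  define \<Phi>' where "\<Phi>' y = id_blinfun - (Blinfun B o\<^sub>L H' x) + (Blinfun B o\<^sub>L H' y)" for y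
  have app: "blinfun_apply (Blinfun B) = B" using BB by (rule bounded_linear_Blinfun_apply)
  have D: "(\<Phi> has_derivative blinfun_apply (\<Phi>' y)) (at y)" if "y \<in> S" for y
  proof -
    have "(\<Phi> has_derivative (\<lambda>h. h - B (H' x h) + B (H' y h))) (at y)"
      unfolding \<Phi>_def
      by (intro has_derivative_add has_derivative_diff has_derivative_ident
          bounded_linear.has_derivative[OF BB] H that
          bounded_linear_imp_has_derivative[OF blinfun.bounded_linear_right])
    moreover have "blinfun_apply (\<Phi>' y) = (\<lambda>h. h - B (H' x h) + B (H' y h))"
      by (simp add: fun_eq_iff \<Phi>'_def blinfun.add_left blinfun.diff_left app)
    ultimately show ?thesis by simp
  qed
  have C: "continuous_on S \<Phi>'" unfolding \<Phi>'_def by (intro continuous_intros cont)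
  have I: "\<Phi>' x = id_blinfun" by (simp add: \<Phi>'_def)
  have "id_blinfun o\<^sub>L \<Phi>' x = id_blinfun" unfolding I by (rule blinfun_eqI) simp
  from inverse_function_theorem[OF S(1) D C S(2) this]
  obtain U V g g' where *: "open U" "U \<subseteq> S" "x \<in> U" "open V" "\<Phi> x \<in> V" "homeomorphism U V \<Phi> g"
    "\<And>y. y \<in> V \<Longrightarrow> (g has_derivative g' y) (at y)"
    "\<And>y. y \<in> V \<Longrightarrow> g' y = inv (blinfun_apply (\<Phi>' (g y)))" by metis
  have "g (\<Phi> x) = x" using * by (simp add: homeomorphism_def)
  then have "g' (\<Phi> x) = id" using *(8)[OF *(5)] I by (simp add: id_def)
  moreover have "H' x (\<Phi> y) = H y" for y
    by (simp add: \<Phi>_def blinfun.add_right blinfun.diff_right B)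
  ultimately show ?thesis using that[of U V \<Phi> g g'] * by blast
qed

lemma dim_kernel_surj:
  fixes L :: "'a::euclidean_space \<Rightarrow> 'b::euclidean_space"
  assumes "linear L" "linear B" "\<And>z. L (B z) = z"
  shows "dim {v. L v = 0} + DIM('b) = DIM('a)"
proof -
  have s: "subspace {v. L v = 0}" using assms(1) by (rule linear_subspace_kernel)
  have sB: "subspace (range B)" using assms(2) by (simp add: linear_subspace_image)
  have "dim {x + y |x y. x \<in> {v. L v = 0} \<and> y \<in> range B} + dim ({v. L v = 0} \<inter> range B) =
    dim {v. L v = 0} + dim (range B)"
    by (rule dim_sums_Int[OF s sB])
  moreover have "{x + y |x y. x \<in> {v. L v = 0} \<and> y \<in> range B} = UNIV"
  proof (intro set_eqI iffI UNIV_I)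
    fix v have "v = (v - B (L v)) + B (L v)" "L (v - B (L v)) = 0"
      using assms by (auto simp: linear_diff)
    then show "v \<in> {x + y |x y. x \<in> {v. L v = 0} \<and> y \<in> range B}" by blast
  qed
  moreover have "{v. L v = 0} \<inter> range B = {0}"
    using assms(3) linear_0[OF assms(1)] linear_0[OF assms(2)] by (auto simp: image_iff)
  moreover have "inj B" using assms(3) by (metis injI)
  then have "dim (range B) = DIM('b)" using dim_image_eq[OF assms(2), of UNIV] by (simp add: inj_on_def)
  ultimately show ?thesis by simp
qed

text \<open>The zero set of \<open>F\<close> lies in that of \<open>G\<close>, and both have the
  same dimension. Read in charts that straighten both, the inclusion is a continuous injection
  between linear spaces of equal dimension, hence open by invariance of domain.\<close>

lemma level_set_inclusion_open:
  fixes F :: "'a::euclidean_space \<Rightarrow> 'b::euclidean_space" and G :: "'a \<Rightarrow> 'c::euclidean_space"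
  assumes S: "open S" "x \<in> S"
    and F: "\<And>y. y \<in> S \<Longrightarrow> (F has_derivative blinfun_apply (F' y)) (at y)" "continuous_on S F'" "surj (blinfun_apply (F' x))"
    and G: "\<And>y. y \<in> S \<Longrightarrow> (G has_derivative blinfun_apply (G' y)) (at y)" "continuous_on S G'" "surj (blinfun_apply (G' x))"
    and dim: "DIM('b) = DIM('c)"
    and sub: "\<And>y. y \<in> S \<Longrightarrow> F y = 0 \<Longrightarrow> G y = 0" and x: "F x = 0"
  obtains T where "open T" "x \<in> T" "T \<subseteq> S" "\<And>y. y \<in> T \<Longrightarrow> G y = 0 \<Longrightarrow> F y = 0"
proof -
  have lin: "linear (blinfun_apply (F' x))" "linear (blinfun_apply (G' x))"
    by (simp_all add: blinfun.bounded_linear_right bounded_linear.linear)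
  obtain B1 where B1: "linear B1" "\<And>z. F' x (B1 z) = z"
    using linear_surjective_right_inverse[OF lin(1) F(3)] by (auto simp: fun_eq_iff)
  obtain B2 where B2: "linear B2" "\<And>z. G' x (B2 z) = z"
    using linear_surjective_right_inverse[OF lin(2) G(3)] by (auto simp: fun_eq_iff)
  obtain U1 V1 \<Phi>1 g1 g1' where 1: "open U1" "x \<in> U1" "U1 \<subseteq> S" "open V1" "homeomorphism U1 V1 \<Phi>1 g1"
    "\<And>y. y \<in> U1 \<Longrightarrow> F' x (\<Phi>1 y) = F y" "\<And>z. z \<in> V1 \<Longrightarrow> (g1 has_derivative g1' z) (at z)" "g1' (\<Phi>1 x) = id"
    using submersion_chart[where H = F, OF S F(1,2) B1] by metis
  obtain U2 V2 \<Phi>2 g2 g2' where 2: "open U2" "x \<in> U2" "U2 \<subseteq> S" "open V2" "homeomorphism U2 V2 \<Phi>2 g2"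
    "\<And>y. y \<in> U2 \<Longrightarrow> G' x (\<Phi>2 y) = G y" "\<And>z. z \<in> V2 \<Longrightarrow> (g2 has_derivative g2' z) (at z)" "g2' (\<Phi>2 x) = id"
    using submersion_chart[where H = G, OF S G(1,2) B2] by metis
  note h1 = 1(5)[unfolded homeomorphism_def] and h2 = 2(5)[unfolded homeomorphism_def]
  define W where "W = U1 \<inter> U2"
  have W: "open W" "x \<in> W" using 1 2 by (auto simp: W_def)
  define K1 where "K1 = {v. F' x v = 0}"
  define K2 where "K2 = {v. G' x v = 0}"
  have "openin (top_of_set V1) (\<Phi>1 ` W)"
    using homeomorphism_imp_open_map[OF 1(5)] W(1) by (simp add: W_def openin_open_eq 1(1))
  then have oW: "open (\<Phi>1 ` W)" using 1(4) openin_open_trans by blast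
  define A where "A = K1 \<inter> \<Phi>1 ` W"
  have A: "A = \<Phi>1 ` {y \<in> W. F y = 0}" using 1(6) by (auto simp: A_def K1_def W_def)
  have gA: "g1 (\<Phi>1 y) = y" if "y \<in> W" for y using that h1 by (auto simp: W_def)
  have "openin (top_of_set K2) ((\<Phi>2 \<circ> g1) ` A)"
  proof (rule invariance_of_domain_subspaces)
    show "openin (top_of_set K1) A" unfolding A_def using oW by blast
    show "subspace K1" "subspace K2" unfolding K1_def K2_def by (simp_all add: lin linear_subspace_kernel)
    show "dim K2 \<le> dim K1" unfolding K1_def K2_def
      using dim_kernel_surj[OF lin(1) B1] dim_kernel_surj[OF lin(2) B2] dim by simp
    have "A \<subseteq> V1" using h1 by (auto simp: A_def W_def)
    moreover have "g1 ` A \<subseteq> U2" using gA by (auto simp: A W_def)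
    ultimately show "continuous_on A (\<Phi>2 \<circ> g1)"
      using h1 h2 by (intro continuous_on_compose) (auto elim: continuous_on_subset)
    show "\<Phi>2 \<circ> g1 \<in> A \<rightarrow> K2" using gA 2(6) sub 1(3) by (auto simp: A K2_def W_def)
    have "inj_on \<Phi>2 U2" using h2 by (metis inj_on_inverseI)
    then show "inj_on (\<Phi>2 \<circ> g1) A" using gA by (auto simp: A inj_on_def W_def)
  qed
  moreover have "(\<Phi>2 \<circ> g1) ` A = \<Phi>2 ` {y \<in> W. F y = 0}" using gA by (force simp: A image_iff)
  ultimately obtain T' where T': "open T'" "\<Phi>2 ` {y \<in> W. F y = 0} = K2 \<inter> T'"
    unfolding openin_open by auto
  \<comment> \<open>\<open>T'\<close> cuts out the image of the zeros of \<open>F\<close> in the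
    second chart, so a zero of \<open>G\<close> in this set shares its chart value with a zero of
    \<open>F\<close> and equals it by injectivity of \<open>\<Phi>2\<close>.\<close>
  define T where "T = W \<inter> (U2 \<inter> \<Phi>2 -` T')"
  show ?thesis
  proof
    have "open (U2 \<inter> \<Phi>2 -` T')" using h2 2(1) T'(1) continuous_open_preimage by blast
    then show "open T" using W by (auto simp: T_def)
    have "\<Phi>2 x \<in> T'" using T'(2) W x by blast
    then show "x \<in> T" using W 2 by (auto simp: T_def)
    show "T \<subseteq> S" using 1 by (auto simp: T_def W_def)
    fix y assume y: "y \<in> T" "G y = 0"
    then have "\<Phi>2 y \<in> K2 \<inter> T'" using 2(6) by (auto simp: T_def K2_def)
    then obtain y' where y': "y' \<in> W" "F y' = 0" "\<Phi>2 y = \<Phi>2 y'" using T'(2) by auto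
    then have "y = y'" using h2 y by (metis IntD1 IntD2 T_def W_def)
    then show "F y = 0" using y' by simp
  qed
qed

text \<open>Each coordinate \<open>e\<^sub>i \<bullet> \<nu>\<close> depends on the coordinate \<open>e\<^sub>i \<bullet> \<psi>\<close> only, and \<open>s\<close> is the derivative of
  either one with respect to it; so \<open>s\<close> depends neither on the second nor on the first coordinate.\<close>

lemma umbilic_factor_constant:
  fixes \<nu> \<psi> :: "'a::real_normed_vector \<Rightarrow> 'b::real_inner"
  assumes \<rho>: "\<rho> > 0" and \<nu>: "\<And>z. z \<in> ball z0 \<rho> \<Longrightarrow> (\<nu> has_derivative (\<lambda>v. s z *\<^sub>R \<psi>' z v)) (at z)"
    and l: "\<And>z v. z \<in> ball z0 \<rho> \<Longrightarrow> e1 \<bullet> \<psi>' z v = l1 v" "\<And>z v. z \<in> ball z0 \<rho> \<Longrightarrow> e2 \<bullet> \<psi>' z v = l2 v"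
    and lin: "bounded_linear l1" "bounded_linear l2"
    and b: "l1 b1 = 1" "l1 b2 = 0" "l2 b1 = 0" "l2 b2 = 1"
  obtains \<delta> where "0 < \<delta>" "\<delta> \<le> \<rho>" "\<And>z. z \<in> ball z0 \<delta> \<Longrightarrow> s z = s z0"
proof -
  \<comment> \<open>Points with the same value of \<open>l\<close> still have it after equal shifts
    along \<open>b\<close>. There e . \<nu> takes the same values, so its derivatives along
    \<open>b\<close>, which are s z and s z', coincide.\<close>
  have key: "s z = s z'" if z: "z \<in> ball z0 \<rho>" "z' \<in> ball z0 \<rho>" and eq: "l z = l z'"
    and ll: "\<And>z v. z \<in> ball z0 \<rho> \<Longrightarrow> e \<bullet> \<psi>' z v = l v" and "bounded_linear l" and bb: "l b = 1" for z z' l e b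
  proof -
    interpret l: bounded_linear l by fact
    have D: "((\<lambda>z. e \<bullet> \<nu> z) has_derivative (\<lambda>v. s z * l v)) (at z)" if "z \<in> ball z0 \<rho>" for z
      using has_derivative_inner_right[OF \<nu>[OF that], of e] by (simp add: ll[OF that])
    have const: "e \<bullet> \<nu> z = e \<bullet> \<nu> z'" if z: "z \<in> ball z0 \<rho>" "z' \<in> ball z0 \<rho>" and eq: "l z = l z'" for z z'
    proof -
      define \<phi> where "\<phi> t = e \<bullet> \<nu> (z + t *\<^sub>R (z' - z))" for t
      have "(\<phi> has_derivative (\<lambda>h. 0)) (at t within {0..1})" if t: "t \<in> {0..1}" for t
      proof -
        have "z + t *\<^sub>R (z' - z) = (1 - t) *\<^sub>R z + t *\<^sub>R z'" by (simp add: algebra_simps)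
        then have in_ball: "z + t *\<^sub>R (z' - z) \<in> ball z0 \<rho>"
          using convexD_alt[OF convex_ball z(1) z(2), of t] t by auto
        have "(\<phi> has_derivative (\<lambda>h. s (z + t *\<^sub>R (z' - z)) * l (h *\<^sub>R (z' - z)))) (at t within {0..1})"
          unfolding \<phi>_def
          by (rule has_derivative_compose[where f = "\<lambda>t. z + t *\<^sub>R (z' - z)", OF _ D[OF in_ball]])
            (auto intro!: derivative_eq_intros)
        then show ?thesis by (simp add: l.scaleR l.diff eq)
      qed
      then have "\<phi> 0 = \<phi> 1" by (intro has_derivative_zero_unique[of "{0..1}"]) auto
      then show ?thesis by (simp add: \<phi>_def)
    qed
    have line: "((\<lambda>t. e \<bullet> \<nu> (z + t *\<^sub>R b)) has_derivative (\<lambda>h. s z * h)) (at 0)" if z: "z \<in> ball z0 \<rho>" for z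
    proof -
      have "((\<lambda>t. z + t *\<^sub>R b) has_derivative (\<lambda>t. t *\<^sub>R b)) (at 0)" by (auto intro!: derivative_eq_intros)
      from has_derivative_compose[OF this, of "\<lambda>z. e \<bullet> \<nu> z" "\<lambda>v. s z * l v"]
      show ?thesis using D[OF z] by (simp add: l.scaleR bb)
    qed
    have ev: "\<forall>\<^sub>F t in at 0. z + t *\<^sub>R b \<in> ball z0 \<rho>" if "z \<in> ball z0 \<rho>" for z
    proof -
      have "((\<lambda>t. z + t *\<^sub>R b) \<longlongrightarrow> z + 0 *\<^sub>R b) (at 0)" by (intro tendsto_intros)
      then show ?thesis using topological_tendstoD[of _ _ _ "ball z0 \<rho>"] that by simp
    qed
    have "\<forall>\<^sub>F t in at 0. e \<bullet> \<nu> (z + t *\<^sub>R b) = e \<bullet> \<nu> (z' + t *\<^sub>R b)"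
      using ev[OF z(1)] ev[OF z(2)] by eventually_elim (auto intro!: const simp: l.add l.scaleR eq)
    then have "((\<lambda>t. e \<bullet> \<nu> (z' + t *\<^sub>R b)) has_derivative (\<lambda>h. s z * h)) (at 0)"
      using has_derivative_transform_eventually[OF line[OF z(1)]] const[OF z(1,2) eq] by simp
    from has_derivative_unique[OF this line[OF z(2)]] show ?thesis
      by (simp add: fun_eq_iff) (metis mult.right_neutral)
  qed
  interpret l1: bounded_linear l1 by fact
  interpret l2: bounded_linear l2 by fact
  have "continuous (at z0) (\<lambda>z. z0 + l1 (z - z0) *\<^sub>R b1)"
    by (intro continuous_intros l1.continuous)
  then obtain d where d: "d > 0" "\<And>z. dist z z0 < d \<Longrightarrow> dist (z0 + l1 (z - z0) *\<^sub>R b1) z0 < \<rho>"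
    using \<rho> unfolding continuous_at_eps_delta by (auto simp: l1.zero)
  show ?thesis
  proof
    show "0 < min d \<rho>" "min d \<rho> \<le> \<rho>" using d \<rho> by auto
    fix z assume z: "z \<in> ball z0 (min d \<rho>)"
    \<comment> \<open>This point has the \<open>l1\<close> coordinate of \<open>z\<close> and the
      \<open>l2\<close> coordinate of \<open>z0\<close>, so \<open>z\<close> and \<open>z0\<close>
      are joined by two applications of \<open>key\<close>. The radius \<open>d\<close> keeps it
      inside the ball.\<close>
    let ?z = "z0 + l1 (z - z0) *\<^sub>R b1"
    have z': "?z \<in> ball z0 \<rho>" using d(2)[of z] z by (auto simp: dist_commute)
    have "s z = s ?z"
      by (rule key[OF _ z' _ l(1) lin(1) b(1)]) (use z b in \<open>auto simp: l1.add l1.diff l1.scaleR\<close>)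
    also have "\<dots> = s z0"
      by (rule key[OF z' _ _ l(2) lin(2) b(4)]) (use \<rho> b in \<open>auto simp: l2.add l2.scaleR\<close>)
    finally show "s z = s z0" .
  qed
qed

section \<open>Tangent spaces of hypersurfaces\<close>

lemma TM_curve_compose:
  assumes f: "(f has_derivative f') (at (\<gamma> 0) within M)" and e: "e > 0"
    and \<gamma>: "\<And>t. t \<in> {-e<..<e} \<Longrightarrow> \<gamma> t \<in> M" "(\<gamma> has_vector_derivative v) (at 0)"
  shows "((f \<circ> \<gamma>) has_vector_derivative f' v) (at 0)"
proof -
  have o: "at 0 within {-e<..<e} = at 0" using e by (intro at_within_open) auto
  have "(\<gamma> has_derivative (\<lambda>h. h *\<^sub>R v)) (at 0 within {-e<..<e})"
    using \<gamma>(2) by (simp add: has_vector_derivative_def o)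
  moreover have "(f has_derivative f') (at (\<gamma> 0) within \<gamma> ` {-e<..<e})"
    using f \<gamma>(1) by (rule_tac has_derivative_subset) auto
  ultimately have "((\<lambda>t. f (\<gamma> t)) has_derivative (\<lambda>h. f' (h *\<^sub>R v))) (at 0)"
    using has_derivative_in_compose o by metis
  then show ?thesis
    using linear_scale[OF has_derivative_linear[OF f]] by (simp add: has_vector_derivative_def o_def)
qed

text \<open>A derivative within a thin set is not determined as a linear map of the ambient space.
  On a tangent vector it is forced, being the velocity of \<open>f\<close> along a curve in
  \<open>M\<close>.\<close>

lemma has_derivative_TM_unique:
  assumes f: "(f has_derivative f') (at x within M)" and g: "(f has_derivative g') (at x within M)"
    and v: "v \<in> TM M x"
  shows "f' v = g' v"
proof -
  obtain \<gamma> e where *: "e > 0" "\<forall>t\<in>{-e<..<e}. \<gamma> t \<in> M" "\<gamma> 0 = x" "(\<gamma> has_vector_derivative v) (at 0)"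
    using v unfolding TM_def by blast
  show ?thesis
    using TM_curve_compose[of f f' \<gamma> M e v] TM_curve_compose[of f g' \<gamma> M e v] f g *
    by (metis vector_derivative_unique_at)
qed

text \<open>This allows an identity valid only on \<open>M\<close>, such as |u|^2 = 1/4, to be
  differentiated in tangent directions.\<close>

lemma has_derivative_TM_cong:
  assumes f: "(f has_derivative f') (at x within M)" and g: "(g has_derivative g') (at x within M)"
    and eq: "open T" "x \<in> T" "x \<in> M" "\<And>y. y \<in> M \<Longrightarrow> y \<in> T \<Longrightarrow> f y = g y"
    and v: "v \<in> TM M x"
  shows "f' v = g' v"
proof -
  have "\<forall>\<^sub>F y in at x within M. f y = g y"
    using eq unfolding eventually_at_topological by blast
  then have "(g has_derivative f') (at x within M)"
    using has_derivative_transform_eventually[OF f] eq by blast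
  then show ?thesis using has_derivative_TM_unique g v by blast
qed

text \<open>Differentiating F = 0 along a curve gives one inclusion. For the other, the straight
  line \<Phi> x + t v stays in the kernel of the linearisation, and the inverse chart bends it into
  a curve in \<open>M\<close> with velocity v.\<close>

lemma TM_eq_kernel:
  fixes F :: "quat \<times> quat \<Rightarrow> 'b::euclidean_space"
  assumes T: "open T" "x \<in> T" "x \<in> M" and F: "smooth_on T F"
    and surj: "surj (frechet_derivative F (at x))" and M: "M \<inter> T = {y \<in> T. F y = 0}"
  shows "TM M x = {v. frechet_derivative F (at x) v = 0}"
proof (intro set_eqI iffI CollectI)
  fix v assume v: "v \<in> TM M x"
  show "frechet_derivative F (at x) v = 0"
    by (rule has_derivative_TM_cong[OF _ has_derivative_const[of 0] T _ v, of F])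
      (use M in \<open>auto intro: has_derivative_at_withinI smooth_on_has_derivative[OF F T(2)]\<close>)
next
  fix v assume "v \<in> {v. frechet_derivative F (at x) v = 0}"
  obtain F' where F': "\<And>x. x \<in> T \<Longrightarrow> (F has_derivative blinfun_apply (F' x)) (at x)"
    "continuous_on T F'" "\<And>x. x \<in> T \<Longrightarrow> blinfun_apply (F' x) = frechet_derivative F (at x)"
    using smooth_on_blinfun_derivative[OF F] by metis
  have v: "F' x v = 0" using \<open>v \<in> _\<close> F'(3) T by simp
  have lin: "linear (blinfun_apply (F' x))"
    by (simp add: blinfun.bounded_linear_right bounded_linear.linear)
  obtain B where B: "linear B" "\<And>z. F' x (B z) = z"
    using linear_surjective_right_inverse[OF lin] surj F'(3) T by (auto simp: fun_eq_iff)
  obtain U V \<Phi> g g' where C: "open U" "x \<in> U" "U \<subseteq> T" "open V" "homeomorphism U V \<Phi> g"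
    "\<And>y. y \<in> U \<Longrightarrow> F' x (\<Phi> y) = F y" "\<And>z. z \<in> V \<Longrightarrow> (g has_derivative g' z) (at z)" "g' (\<Phi> x) = id"
    using submersion_chart[where H = F, OF T(1,2) F'(1,2) B] by metis
  note h = C(5)[unfolded homeomorphism_def]
  have x0: "F x = 0" using M T by blast
  have \<Phi>x: "\<Phi> x \<in> V" using h C(2) by blast
  define \<gamma> where "\<gamma> t = g (\<Phi> x + t *\<^sub>R v)" for t :: real
  have "isCont (\<lambda>t::real. \<Phi> x + t *\<^sub>R v) 0" by (intro continuous_intros)
  then have "((\<lambda>t::real. \<Phi> x + t *\<^sub>R v) \<longlongrightarrow> \<Phi> x) (at 0)" by (simp add: isCont_def)
  then have "\<forall>\<^sub>F t::real in at 0. \<Phi> x + t *\<^sub>R v \<in> V"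
    using topological_tendstoD C(4) \<Phi>x by blast
  then obtain e where e: "e > 0" "\<And>t. t \<noteq> 0 \<Longrightarrow> \<bar>t\<bar> < e \<Longrightarrow> \<Phi> x + t *\<^sub>R v \<in> V"
    by (auto simp: eventually_at)
  have eV: "\<Phi> x + t *\<^sub>R v \<in> V" if "t \<in> {-e<..<e}" for t using e(2)[of t] that \<Phi>x by (cases "t = 0") auto
  have "\<gamma> t \<in> M" if "t \<in> {-e<..<e}" for t
  proof -
    have U: "\<gamma> t \<in> U" "\<Phi> (\<gamma> t) = \<Phi> x + t *\<^sub>R v" using h eV[OF that] by (auto simp: \<gamma>_def)
    then have "F (\<gamma> t) = 0" using C(6)[OF U(1)] C(6)[OF C(2)] x0 v
      by (simp add: blinfun.add_right blinfun.scaleR_right)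
    then show ?thesis using M U C(3) by blast
  qed
  moreover have "\<gamma> 0 = x" using h C(2) by (simp add: \<gamma>_def)
  moreover have "(\<gamma> has_vector_derivative v) (at 0)"
  proof -
    have "((\<lambda>t. \<Phi> x + t *\<^sub>R v) has_derivative (\<lambda>t. t *\<^sub>R v)) (at 0)" by (auto intro!: derivative_eq_intros)
    from has_derivative_compose[OF this, of g "g' (\<Phi> x)"] C(7)[OF \<Phi>x] C(8)
    show ?thesis by (simp add: \<gamma>_def[abs_def] has_vector_derivative_def)
  qed
  ultimately show "v \<in> TM M x" unfolding TM_def using e(1) by blast
qed

text \<open>Since derivatives of \<open>F\<close> are available one direction at a time,
  \<open>X\<close> is expanded in the basis and the product rule is applied to each term. Symmetry
  of second derivatives gives the linearity needed to reassemble the sum.\<close>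

lemma has_derivative_dderiv_along:
  fixes F :: "'a::euclidean_space \<Rightarrow> 'b::euclidean_space"
  assumes F: "smooth_on S F" "x \<in> S" and xM: "x \<in> M" and X: "(X has_derivative X') (at x within M)"
  shows "((\<lambda>y. frechet_derivative F (at y) (X y)) has_derivative
    (\<lambda>v. frechet_derivative (\<lambda>y. frechet_derivative F (at y) (X x)) (at x) v + frechet_derivative F (at x) (X' v)))
    (at x within M)"
proof -
  let ?D = "\<lambda>y. frechet_derivative F (at y)"
  let ?D2 = "\<lambda>w. frechet_derivative (\<lambda>y. ?D y w) (at x)"
  have S: "open S" using F by (simp add: smooth_on_def)
  have exp: "f w = (\<Sum>b\<in>Basis. (w \<bullet> b) *\<^sub>R f b)" if "linear f" for f :: "'a \<Rightarrow> 'b" and w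
    using linear_sum[OF that, of "\<lambda>b. (w \<bullet> b) *\<^sub>R b" Basis] linear_scale[OF that] by (simp add: euclidean_representation)
  have lin: "linear (?D y)" if "y \<in> S" for y
    using smooth_on_has_derivative[OF F(1) that] by (rule has_derivative_linear)
  have lin2: "linear (\<lambda>w. ?D2 w v)" for v
  proof -
    have "(\<lambda>w. ?D2 w v) = ?D2 v" using symmetric_second_derivative[OF F] by blast
    then show ?thesis
      using has_derivative_linear[OF smooth_on_has_derivative[OF smooth_on_dderiv[OF F(1)] F(2)]] by simp
  qed
  have "((\<lambda>y. \<Sum>b\<in>Basis. (X y \<bullet> b) *\<^sub>R ?D y b) has_derivative
    (\<lambda>v. \<Sum>b\<in>Basis. (X x \<bullet> b) *\<^sub>R ?D2 b v + (X' v \<bullet> b) *\<^sub>R ?D x b)) (at x within M)"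
    by (intro has_derivative_sum has_derivative_scaleR has_derivative_inner_left X
        has_derivative_at_withinI[OF smooth_on_has_derivative[OF smooth_on_dderiv[OF F(1)] F(2)]])
  moreover have "(\<Sum>b\<in>Basis. (X x \<bullet> b) *\<^sub>R ?D2 b v + (X' v \<bullet> b) *\<^sub>R ?D x b) = ?D2 (X x) v + ?D x (X' v)" for v
    using exp[OF lin2, of "X x" v] exp[OF lin[OF F(2)], of "X' v"] by (simp only: sum.distrib)
  ultimately have *: "((\<lambda>y. \<Sum>b\<in>Basis. (X y \<bullet> b) *\<^sub>R ?D y b) has_derivative
    (\<lambda>v. ?D2 (X x) v + ?D x (X' v))) (at x within M)" by simp
  have eq: "(\<Sum>b\<in>Basis. (X y \<bullet> b) *\<^sub>R ?D y b) = ?D y (X y)" if "y \<in> S" for y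
    using exp[OF lin[OF that], of "X y"] by simp
  then have "\<forall>\<^sub>F y in at x within M. (\<Sum>b\<in>Basis. (X y \<bullet> b) *\<^sub>R ?D y b) = ?D y (X y)"
    unfolding eventually_at_topological using S F(2) by blast
  from has_derivative_transform_eventually[OF * this eq[OF F(2)] xM] show ?thesis by simp
qed

text \<open>Differentiate DF(X) = 0 along Y and DF(Y) = 0 along X: the second derivatives of
  \<open>F\<close> cancel by symmetry and leave DF of the bracket. The fields need only be
  differentiable within \<open>M\<close>.\<close>

lemma bracket_tangent:
  fixes F :: "quat \<times> quat \<Rightarrow> 'b::euclidean_space"
  assumes F: "smooth_on S F" "x \<in> S" "x \<in> M"
    and X: "(X has_derivative X') (at x within M)" "\<And>y. y \<in> M \<Longrightarrow> y \<in> S \<Longrightarrow> frechet_derivative F (at y) (X y) = 0" "X x \<in> TM M x"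
    and Y: "(Y has_derivative Y') (at x within M)" "\<And>y. y \<in> M \<Longrightarrow> y \<in> S \<Longrightarrow> frechet_derivative F (at y) (Y y) = 0" "Y x \<in> TM M x"
  shows "frechet_derivative F (at x) (X' (Y x) - Y' (X x)) = 0"
proof -
  have S: "open S" using F by (simp add: smooth_on_def)
  have 1: "frechet_derivative (\<lambda>y. frechet_derivative F (at y) (X x)) (at x) (Y x) + frechet_derivative F (at x) (X' (Y x)) = 0"
    by (rule has_derivative_TM_cong[OF has_derivative_dderiv_along[OF F(1-3) X(1)] has_derivative_const[of 0] S F(2,3) X(2) Y(3)])
  have 2: "frechet_derivative (\<lambda>y. frechet_derivative F (at y) (Y x)) (at x) (X x) + frechet_derivative F (at x) (Y' (X x)) = 0"
    by (rule has_derivative_TM_cong[OF has_derivative_dderiv_along[OF F(1-3) Y(1)] has_derivative_const[of 0] S F(2,3) Y(2) X(3)])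
  have lin: "linear (frechet_derivative F (at x))"
    using smooth_on_has_derivative[OF F(1,2)] by (rule has_derivative_linear)
  have "b - d = 0" if "a + b = 0" "c + d = 0" "a = c" for a b c d :: 'b
    using that by (auto simp: add_eq_0_iff)
  from this[OF 1 2 symmetric_second_derivative[OF F(1,2)]] show ?thesis
    unfolding linear_diff[OF lin] .
qed

section \<open>The shape operator\<close>

lemma qcross_component1 [simp]: "qcross y z $ 1 = 0"
  by (simp add: qcross_def qmul_def)

lemma qcross_orthogonal: "y $ 1 = 0 \<Longrightarrow> z $ 1 = 0 \<Longrightarrow> y \<bullet> qcross y z = 0 \<and> z \<bullet> qcross y z = 0"
  by (simp add: qcross_def qmul_def inner_quat algebra_simps)

lemma qcross_qcross:
  "y $ 1 = 0 \<Longrightarrow> z $ 1 = 0 \<Longrightarrow> z \<bullet> y = 0 \<Longrightarrow> qcross (qcross y z) z = - (z \<bullet> z) *\<^sub>R y"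
  by (simp add: qcross_def qmul_def inner_quat vec_eq_iff forall_4) algebra

lemma norm_qcross:
  "y $ 1 = 0 \<Longrightarrow> z $ 1 = 0 \<Longrightarrow> qcross y z \<bullet> qcross y z = (y \<bullet> y) * (z \<bullet> z) - (y \<bullet> z)\<^sup>2"
  by (simp add: qcross_def qmul_def inner_quat power2_eq_square field_simps)

lemma orthonormal_pair:
  fixes u :: quat
  assumes u: "u $ 1 = 0" "u \<bullet> u = 1/4"
  obtains f1 f2 where "f1 $ 1 = 0" "f2 $ 1 = 0" "u \<bullet> f1 = 0" "u \<bullet> f2 = 0"
    "f1 \<bullet> f1 = 1" "f2 \<bullet> f2 = 1" "f1 \<bullet> f2 = 0"
    "\<forall>c. c $ 1 = 0 \<longrightarrow> u \<bullet> c = 0 \<longrightarrow> c = (c \<bullet> f1) *\<^sub>R f1 + (c \<bullet> f2) *\<^sub>R f2"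
proof -
  obtain f where f: "f $ 1 = 0" "u \<bullet> f = 0" "f \<noteq> 0"
  proof (cases "u $ 2 = 0 \<and> u $ 3 = 0")
    case True
    show ?thesis by (rule that[of "\<chi> i. if i = 2 then 1 else 0"])
      (use True in \<open>auto simp: inner_quat vec_eq_iff exI[of _ 2]\<close>)
  next
    case False
    show ?thesis by (rule that[of "\<chi> i. if i = 2 then - u $ 3 else if i = 3 then u $ 2 else 0"])
      (use False in \<open>auto simp: inner_quat vec_eq_iff forall_4\<close>)
  qed
  define f1 where "f1 = (1 / norm f) *\<^sub>R f"
  \<comment> \<open>The factor 2 normalises the vector product, because u has length 1/2.\<close>
  define f2 where "f2 = 2 *\<^sub>R qcross u f1"
  have f1: "f1 $ 1 = 0" "u \<bullet> f1 = 0" "f1 \<bullet> f1 = 1"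
    using f by (auto simp: f1_def power2_norm_eq_inner[symmetric] power2_eq_square[symmetric] divide_simps dot_square_norm)
  have f2: "f2 $ 1 = 0" "u \<bullet> f2 = 0" "f1 \<bullet> f2 = 0" "f2 \<bullet> f2 = 1"
    using qcross_orthogonal[OF u(1) f1(1)] norm_qcross[OF u(1) f1(1)] u f1 by (auto simp: f2_def)
  let ?B = "{qreal 1, u, f1, f2}"
  have q1: "qreal 1 \<bullet> z = z $ 1" for z by (simp add: inner_quat qreal_def)
  have orth: "pairwise orthogonal ?B"
    using u f1 f2 q1 by (auto simp: pairwise_def orthogonal_def inner_commute)
  have nz: "0 \<notin> ?B" using u f1 f2 q1[of "qreal 1"] by auto
  have d: "qreal 1 \<noteq> u" "qreal 1 \<noteq> f1" "qreal 1 \<noteq> f2" "u \<noteq> f1" "u \<noteq> f2" "f1 \<noteq> f2"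
    using u f1 f2 q1[of "qreal 1"] by (metis qreal_component1 zero_neq_one)+
  have "card ?B = 4" using d by simp
  then have "UNIV \<subseteq> span ?B"
    using pairwise_orthogonal_independent[OF orth nz] by (intro card_ge_dim_independent) auto
  have "c = (c \<bullet> f1) *\<^sub>R f1 + (c \<bullet> f2) *\<^sub>R f2" if c: "c $ 1 = 0" "u \<bullet> c = 0" for c
  proof -
    let ?d = "c - (c \<bullet> f1) *\<^sub>R f1 - (c \<bullet> f2) *\<^sub>R f2"
    have sym: "z \<bullet> qreal 1 = z $ 1" "f1 \<bullet> u = 0" "f2 \<bullet> u = 0" "f2 \<bullet> f1 = 0" "c \<bullet> u = 0" for z
      using c f1 f2 q1 by (simp_all add: inner_commute)
    have "orthogonal ?d z" if "z \<in> ?B" for z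
      using that c f1 f2 by (auto simp: orthogonal_def inner_diff_left sym)
    then have "orthogonal ?d ?d"
      using orthogonal_to_span[of ?d ?B ?d] \<open>UNIV \<subseteq> span ?B\<close> by blast
    then have "?d = 0" by (simp only: orthogonal_self)
    then show ?thesis by (simp add: algebra_simps)
  qed
  then show ?thesis using that f1 f2 by blast
qed

text \<open>The eigenvalues solve (s - A)(s - C) = B^2, whose discriminant (A - C)^2 + 4 B^2 is
  positive unless the matrix is scalar. For nonzero B an eigenvector is B f1 + (s - A) f2, which is
  nonzero because of its first coordinate.\<close>

lemma symmetric_plane_eigenvectors:
  fixes f1 f2 :: "'a::real_inner" and T :: "'a \<Rightarrow> 'a"
  assumes T: "linear T" and f: "f1 \<bullet> f1 = 1" "f2 \<bullet> f2 = 1" "f1 \<bullet> f2 = 0"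
    and Tf: "T f1 = A *\<^sub>R f1 + B *\<^sub>R f2" "T f2 = B *\<^sub>R f1 + C *\<^sub>R f2" and ne: "B \<noteq> 0 \<or> A \<noteq> C"
  obtains s1 s2 x1 y1 x2 y2 where "s1 \<noteq> s2"
    "x1 *\<^sub>R f1 + y1 *\<^sub>R f2 \<noteq> 0" "T (x1 *\<^sub>R f1 + y1 *\<^sub>R f2) = s1 *\<^sub>R (x1 *\<^sub>R f1 + y1 *\<^sub>R f2)"
    "x2 *\<^sub>R f1 + y2 *\<^sub>R f2 \<noteq> 0" "T (x2 *\<^sub>R f1 + y2 *\<^sub>R f2) = s2 *\<^sub>R (x2 *\<^sub>R f1 + y2 *\<^sub>R f2)"
proof (cases "B = 0")
  case True
  have "f1 \<noteq> 0" "f2 \<noteq> 0" using f by auto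
  then show ?thesis using that[of A C 1 0 0 1] True ne Tf by simp
next
  case False
  define D where "D = sqrt ((A - C)\<^sup>2 + 4 * B\<^sup>2)"
  have D: "D\<^sup>2 = (A - C)\<^sup>2 + 4 * B\<^sup>2" "D > 0" using False by (auto simp: D_def add_nonneg_pos)
  have ev: "T (B *\<^sub>R f1 + (s - A) *\<^sub>R f2) = s *\<^sub>R (B *\<^sub>R f1 + (s - A) *\<^sub>R f2)" if "(s - A) * (s - C) = B * B" for s
  proof -
    have "T (B *\<^sub>R f1 + (s - A) *\<^sub>R f2) = (B * s) *\<^sub>R f1 + (B * B + (s - A) * C) *\<^sub>R f2"
      by (simp add: linear_add[OF T] linear_scale[OF T] Tf) (simp add: algebra_simps)
    also have "B * B + (s - A) * C = s * (s - A)" using that by algebra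
    finally show ?thesis by (simp add: algebra_simps)
  qed
  have nz: "B *\<^sub>R f1 + y *\<^sub>R f2 \<noteq> 0" for y
  proof
    assume "B *\<^sub>R f1 + y *\<^sub>R f2 = 0"
    then have "f1 \<bullet> (B *\<^sub>R f1 + y *\<^sub>R f2) = 0" by simp
    then show False using False f by (simp add: inner_add_right)
  qed
  have r: "((A + C + D) / 2 - A) * ((A + C + D) / 2 - C) = B * B" "((A + C - D) / 2 - A) * ((A + C - D) / 2 - C) = B * B"
    using D(1) by (simp_all add: field_simps power2_eq_square)
  show ?thesis
    by (rule that[OF _ nz ev[OF r(1)] nz ev[OF r(2)]]) (use D(2) in simp)
qed

lemma qmul_anticommute_sum: "y $ 1 = 0 \<Longrightarrow> z $ 1 = 0 \<Longrightarrow> qmul y z + qmul z y = qreal (- 2 * (y \<bullet> z))"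
  by (simp add: qmul_def inner_quat qreal_def vec_eq_iff forall_4)

lemma PNK_lframe: "x \<in> NK \<Longrightarrow> PNK x (lframe x \<alpha> \<beta>) = lframe x \<beta> \<alpha>"
  using NK_S3[of x] by (simp add: PNK_def lframe_def qmul_assoc S3_cancel)

lemma qcross_scaleR: "qcross (k *\<^sub>R y) z = k *\<^sub>R qcross y z"
  by (simp add: qcross_def qmul.scaleR_left qmul.scaleR_right scaleR_diff_right)

lemma inner_two_mult [simp]: "y \<bullet> (2 * z) = 2 * (y \<bullet> z)" for y z :: quat
  by (simp only: mult_2 inner_add_right)

section \<open>The normal and the tangent spaces of the hypersurface\<close>

locale PNK_hypersurface =
  fixes M :: "(quat \<times> quat) set" and \<xi> :: "quat \<times> quat \<Rightarrow> quat \<times> quat"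
  assumes hyp: "hypersurface_NK M" and nor: "unit_normal M \<xi>"
    and P\<xi>: "\<And>x. x \<in> M \<Longrightarrow> PNK x (\<xi> x) = - \<xi> x"
begin

definition u :: "quat \<times> quat \<Rightarrow> quat" where
  "u x = qmul (qcnj (fst x)) (fst (\<xi> x))"

lemma M_NK: "x \<in> M \<Longrightarrow> x \<in> NK"
  using hyp by (auto simp: hypersurface_NK_def)

text \<open>P swaps the two coordinates, so P \<xi> = - \<xi> makes them opposite. On such pairs the
  metric is 4 |u|^2, whence the value 1/4.\<close>

lemma \<xi>_lframe: "x \<in> M \<Longrightarrow> \<xi> x = lframe x (u x) (- u x)"
  and u_imag: "x \<in> M \<Longrightarrow> u x $ 1 = 0"
  and u_norm: "x \<in> M \<Longrightarrow> u x \<bullet> u x = 1/4"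
proof -
  assume x: "x \<in> M"
  note N = M_NK[OF x]
  have \<xi>: "\<xi> x \<in> TN x" "gNK x (\<xi> x) (\<xi> x) = 1" using nor x by (auto simp: unit_normal_def)
  obtain \<alpha> \<beta> where *: "\<xi> x = lframe x \<alpha> \<beta>" "\<alpha> $ 1 = 0" "\<beta> $ 1 = 0"
    by (rule lframe_exhaust[OF N \<xi>(1)])
  have "\<beta> = - \<alpha>" using P\<xi>[OF x] unfolding *(1) PNK_lframe[OF N] lframe_minus lframe_inject[OF N] by (rule conjunct1)
  moreover have "\<alpha> = u x" unfolding u_def *(1) using NK_S3[OF N] by (simp add: lframe_def S3_cancel)
  ultimately show "\<xi> x = lframe x (u x) (- u x)" "u x $ 1 = 0" "u x \<bullet> u x = 1/4"
    using * \<xi>(2) by (auto simp: gNK_lframe[OF N])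
qed

lemma gNK_\<xi>: "x \<in> M \<Longrightarrow> gNK x (\<xi> x) (lframe x \<alpha> \<beta>) = 2 * (u x \<bullet> (\<alpha> - \<beta>))"
  by (simp add: \<xi>_lframe gNK_lframe M_NK inner_diff_right inner_commute[of _ "u x"] field_simps)

lemma local_equation:
  assumes "x \<in> M"
  obtains T F where "open T" "x \<in> T" "smooth_on T (F :: quat \<times> quat \<Rightarrow> real^3)"
    "\<forall>y\<in>T. surj (frechet_derivative F (at y))" "M \<inter> T = {y\<in>T. F y = 0}"
proof -
  have "\<exists>T (F :: quat \<times> quat \<Rightarrow> real^3). open T \<and> x \<in> T \<and> smooth_on T F \<and>
    (\<forall>y\<in>T. surj (frechet_derivative F (at y))) \<and> M \<inter> T = {y\<in>T. F y = 0}"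
    using hyp assms unfolding hypersurface_NK_def by (elim conjE bspec)
  then show ?thesis using that by (elim exE conjE) (rule that)
qed

text \<open>Tangent vectors satisfy three linear equations, two radial and one from the normal.
  These equations are independent, since the radial vectors and \<xi> provide a right inverse. Both
  sides are therefore 5-dimensional and one inclusion suffices.\<close>

lemma TM_eq:
  assumes x: "x \<in> M"
  shows "TM M x = {lframe x \<alpha> \<beta> |\<alpha> \<beta>. \<alpha> $ 1 = 0 \<and> \<beta> $ 1 = 0 \<and> u x \<bullet> (\<alpha> - \<beta>) = 0}"
proof -
  note N = M_NK[OF x]
  obtain T F where F: "open T" "x \<in> T" "smooth_on T (F :: quat \<times> quat \<Rightarrow> real^3)"
    "\<forall>y\<in>T. surj (frechet_derivative F (at y))" "M \<inter> T = {y\<in>T. F y = 0}"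
    by (rule local_equation[OF x])
  have ker: "TM M x = {v. frechet_derivative F (at x) v = 0}"
    by (rule TM_eq_kernel[OF F(1,2) x F(3) F(4)[rule_format, OF F(2)] F(5)])
  have linF: "linear (frechet_derivative F (at x))"
    using smooth_on_has_derivative[OF F(3,2)] by (rule has_derivative_linear)
  obtain B where B: "linear B" "\<And>z. frechet_derivative F (at x) (B z) = z"
    using linear_surjective_right_inverse[OF linF F(4)[rule_format, OF F(2)]] by (auto simp: fun_eq_iff)
  define R where "R v = (fst x \<bullet> fst v, snd x \<bullet> snd v, gNK x (\<xi> x) v)" for v
  have linR: "linear R"
    by (auto intro!: linearI simp: R_def gNK_def inner_add_right qmul.add_right qmul.scaleR_right
      inner_add_left algebra_simps)
  define C where "C z = (case z of (s, t, k) \<Rightarrow> (s *\<^sub>R fst x, t *\<^sub>R snd x) + k *\<^sub>R \<xi> x)" for z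
  have linC: "linear C"
    by (auto intro!: linearI simp: C_def split_beta algebra_simps)
  have RC: "R (C z) = z" for z
  proof (cases z)
    case (fields s t k)
    have \<xi>: "\<xi> x \<in> TN x" "gNK x (\<xi> x) (\<xi> x) = 1" using nor x by (auto simp: unit_normal_def)
    have n: "fst x \<bullet> fst x = 1" "snd x \<bullet> snd x = 1" using NK_S3[OF N] by (auto simp: S3_inner)
    have "(s *\<^sub>R fst x, t *\<^sub>R snd x) = lframe x (qreal s) (qreal t)" by (simp add: lframe_def)
    then have "gNK x (\<xi> x) (s *\<^sub>R fst x, t *\<^sub>R snd x) = 0"
      using u_imag[OF x] by (simp add: gNK_\<xi>[OF x] inner_quat qreal_def)
    then have "R (s *\<^sub>R fst x, t *\<^sub>R snd x) = (s, t, 0)" by (simp add: R_def n)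
    moreover have "R (\<xi> x) = (0, 0, 1)" using \<xi> by (simp add: R_def TN_def)
    ultimately show ?thesis
      by (simp add: C_def fields linear_add[OF linR] linear_scale[OF linR])
  qed
  have sub: "TM M x \<subseteq> {v. R v = 0}"
  proof (intro subsetI CollectI)
    fix v assume v: "v \<in> TM M x"
    have n: "fst y \<bullet> fst y = 1" "snd y \<bullet> snd y = 1" if "y \<in> M" for y
      using NK_S3[OF M_NK[OF that]] by (auto simp: S3_inner)
    have "2 * (fst x \<bullet> fst v) = 0"
      by (rule has_derivative_TM_cong[of "\<lambda>y. fst y \<bullet> fst y" _ _ _ "\<lambda>_. 1" "\<lambda>_. 0" UNIV])
        (use v x n in \<open>auto intro!: derivative_eq_intros simp: inner_commute\<close>)
    moreover have "2 * (snd x \<bullet> snd v) = 0"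
      by (rule has_derivative_TM_cong[of "\<lambda>y. snd y \<bullet> snd y" _ _ _ "\<lambda>_. 1" "\<lambda>_. 0" UNIV])
        (use v x n in \<open>auto intro!: derivative_eq_intros simp: inner_commute\<close>)
    moreover have "gNK x (\<xi> x) v = 0" using nor x v by (auto simp: unit_normal_def)
    ultimately show "R v = 0" by (simp add: R_def zero_prod_def)
  qed
  have "dim (TM M x) + DIM(real^3) = DIM(quat \<times> quat)"
    unfolding ker by (rule dim_kernel_surj[OF linF B])
  moreover have "dim {v. R v = 0} + DIM(real \<times> real \<times> real) = DIM(quat \<times> quat)"
    by (rule dim_kernel_surj[OF linR linC RC])
  ultimately have "dim {v. R v = 0} \<le> dim (TM M x)" by simp
  then have "TM M x = {v. R v = 0}"
    using linear_subspace_kernel[OF linF] linear_subspace_kernel[OF linR] sub ker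
    by (intro subspace_dim_equal) auto
  also have "\<dots> = {lframe x \<alpha> \<beta> |\<alpha> \<beta>. \<alpha> $ 1 = 0 \<and> \<beta> $ 1 = 0 \<and> u x \<bullet> (\<alpha> - \<beta>) = 0}"
  proof -
    have "R v = 0 \<longleftrightarrow> v \<in> TN x \<and> gNK x (\<xi> x) v = 0" for v by (auto simp: R_def TN_def zero_prod_def)
    then show ?thesis using lframe_exhaust[OF N] by (auto simp: lframe_TN[OF N] gNK_\<xi>[OF x]) (metis gNK_\<xi> mult_eq_0_iff x zero_neq_numeral)
  qed
  finally show ?thesis .
qed

lemma lframe_TM_iff:
  "x \<in> M \<Longrightarrow> lframe x \<alpha> \<beta> \<in> TM M x \<longleftrightarrow> \<alpha> $ 1 = 0 \<and> \<beta> $ 1 = 0 \<and> u x \<bullet> (\<alpha> - \<beta>) = 0"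
  by (auto simp: TM_eq lframe_inject M_NK)

lemma u_derivative:
  assumes x: "x \<in> M"
  obtains u' where "(u has_derivative u') (at x within M)"
proof -
  obtain T \<eta> where \<eta>: "open T" "x \<in> T" "smooth_on T \<eta>" "\<forall>y\<in>M \<inter> T. \<eta> y = \<xi> y"
    using nor x unfolding unit_normal_def by metis
  have D: "(\<eta> has_derivative frechet_derivative \<eta> (at x)) (at x within M)"
    using smooth_on_has_derivative[OF \<eta>(3,2)] by (rule has_derivative_at_withinI)
  have "\<forall>\<^sub>F y in at x within M. \<eta> y = \<xi> y"
    unfolding eventually_at_topological using \<eta> by auto
  then have \<xi>': "(\<xi> has_derivative frechet_derivative \<eta> (at x)) (at x within M)"
    using has_derivative_transform_eventually[OF D] \<eta> x by blast
  have "((\<lambda>y. qmul (qcnj (fst y)) (fst (\<xi> y))) has_derivative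
    (\<lambda>v. qmul (qcnj (fst x)) (fst (frechet_derivative \<eta> (at x) v)) + qmul (qcnj (fst v)) (fst (\<xi> x)))) (at x within M)"
    by (intro qmul.FDERIV has_derivative_qcnj has_derivative_fst \<xi>' has_derivative_ident)
  then show ?thesis using that unfolding u_def[abs_def] by blast
qed

section \<open>The derivative of the normal and the shape operator at one point\<close>

context
  fixes x u'
  assumes x: "x \<in> M" and u': "(u has_derivative u') (at x within M)"
begin

lemma u'_lin: "linear u'"
  using u' by (rule has_derivative_linear)

lemma \<xi>_derivative:
  "(\<xi> has_derivative (\<lambda>v. (qmul (fst x) (u' v) + qmul (fst v) (u x), - (qmul (snd x) (u' v) + qmul (snd v) (u x)))))
    (at x within M)"
proof -
  have "((\<lambda>y. lframe y (u y) (- u y)) has_derivative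
    (\<lambda>v. (qmul (fst x) (u' v) + qmul (fst v) (u x), qmul (snd x) (- u' v) + qmul (snd v) (- u x)))) (at x within M)"
    unfolding lframe_def
    by (intro has_derivative_Pair qmul.FDERIV has_derivative_fst has_derivative_snd has_derivative_ident
      has_derivative_minus u')
  then have "((\<lambda>y. lframe y (u y) (- u y)) has_derivative
    (\<lambda>v. (qmul (fst x) (u' v) + qmul (fst v) (u x), - (qmul (snd x) (u' v) + qmul (snd v) (u x))))) (at x within M)"
    by (simp add: qmul.minus_right)
  then show ?thesis
    by (rule has_derivative_transform[rotated 2, OF _ x]) (simp add: \<xi>_lframe)
qed

lemma u'_tangent:
  assumes v: "v \<in> TM M x"
  shows "u' v $ 1 = 0" "u x \<bullet> u' v = 0"
proof -
  show "u' v $ 1 = 0"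
    by (rule has_derivative_TM_cong[of "\<lambda>y. u y $ 1" _ _ _ "\<lambda>_. 0" "\<lambda>_. 0" UNIV])
      (use v x u_imag in \<open>auto intro!: bounded_linear.has_derivative[OF bounded_linear_vec_nth] u'\<close>)
  have "u x \<bullet> u' v + u' v \<bullet> u x = 0"
    by (rule has_derivative_TM_cong[of "\<lambda>y. u y \<bullet> u y" _ _ _ "\<lambda>_. 1/4" "\<lambda>_. 0" UNIV])
      (use v x u_norm in \<open>auto intro!: has_derivative_inner u'\<close>)
  then show "u x \<bullet> u' v = 0" by (simp add: inner_commute)
qed

text \<open>\<open>frechet_derivative\<close> within \<open>M\<close> is an arbitrary choice of
  derivative, but all choices agree on the tangent vector \<open>X\<close>, so the explicit one for
  (p u, - q u) may be used.\<close>

lemma shapeop_lframe: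
  assumes "a $ 1 = 0" "c $ 1 = 0" "u x \<bullet> c = 0"
  defines "X \<equiv> lframe x (a + c) (a - c)"
  shows "shapeop M \<xi> x X = - lframe x (qcross c (u x) + (u' X + (5/3) *\<^sub>R qcross a (u x)))
    (qcross c (u x) - (u' X + (5/3) *\<^sub>R qcross a (u x)))"
proof -
  have X: "X \<in> TM M x" unfolding X_def lframe_TM_iff[OF x] using assms by (simp add: inner_diff_right inner_add_right del: add_diff_add)
  have "\<xi> differentiable (at x within M)" using \<xi>_derivative by (rule differentiableI)
  then have "frechet_derivative \<xi> (at x within M) X =
    (qmul (fst x) (u' X) + qmul (fst X) (u x), - (qmul (snd x) (u' X) + qmul (snd X) (u x)))"
    using has_derivative_TM_unique[OF _ \<xi>_derivative X] frechet_derivative_works by blast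
  also have "\<dots> = lframe x (qmul (a + c) (u x) + u' X) (- (qmul (a - c) (u x) + u' X))"
    by (simp add: X_def lframe_def qmul.add_right qmul.minus_right qmul.diff_right qmul.add_left qmul.diff_left qmul_assoc)
  finally show ?thesis
    unfolding shapeop_def using nablaNK_lframe[OF M_NK[OF x] u_imag[OF x] assms(1,2) u'_tangent(1)[OF X]]
    by (simp add: \<xi>_lframe[OF x] X_def)
qed

text \<open>The tangent fields are the projections of \<open>(p \<alpha>, q \<beta>)\<close>; their bracket is orthogonal to \<open>\<xi>\<close>.\<close>

lemma u'_bracket:
  assumes X: "lframe x \<alpha> \<beta> \<in> TM M x" and Y: "lframe x \<alpha>' \<beta>' \<in> TM M x"
  shows "u x \<bullet> ((qmul \<alpha>' \<alpha> - qmul \<alpha> \<alpha>') - (qmul \<beta>' \<beta> - qmul \<beta> \<beta>')) =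
    u' (lframe x \<alpha>' \<beta>') \<bullet> (\<alpha> - \<beta>) - u' (lframe x \<alpha> \<beta>) \<bullet> (\<alpha>' - \<beta>')"
proof -
  obtain T F where F: "open T" "x \<in> T" "smooth_on T (F :: quat \<times> quat \<Rightarrow> real^3)"
    "\<forall>y\<in>T. surj (frechet_derivative F (at y))" "M \<inter> T = {y\<in>T. F y = 0}"
    by (rule local_equation[OF x])
  have ker: "TM M y = {v. frechet_derivative F (at y) v = 0}" if "y \<in> M" "y \<in> T" for y
    by (rule TM_eq_kernel[OF F(1) that(2,1) F(3) F(4)[rule_format, OF that(2)] F(5)])
  \<comment> \<open>The metric product of \<xi> with the left-invariant field is 2 u . (\<alpha> -
    \<beta>); subtracting this multiple of \<xi> makes the field tangent at every point of
    \<open>M\<close>.\<close>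
  define Z where "Z \<alpha> \<beta> y = lframe y \<alpha> \<beta> - (2 * (u y \<bullet> (\<alpha> - \<beta>))) *\<^sub>R \<xi> y" for \<alpha> \<beta> y
  \<comment> \<open>The coefficient of \<xi> is zero at \<open>x\<close> when the vector there is
    tangent, so the derivative of \<xi> does not appear.\<close>
  define Z' where "Z' \<alpha> \<beta> v = (qmul (fst v) \<alpha>, qmul (snd v) \<beta>) - (2 * (u' v \<bullet> (\<alpha> - \<beta>))) *\<^sub>R \<xi> x" for \<alpha> \<beta> v
  have Zx: "Z \<alpha> \<beta> x = lframe x \<alpha> \<beta>" if "lframe x \<alpha> \<beta> \<in> TM M x" for \<alpha> \<beta>
    using that by (simp add: Z_def lframe_TM_iff[OF x])
  have Z': "(Z \<alpha> \<beta> has_derivative Z' \<alpha> \<beta>) (at x within M)" if "lframe x \<alpha> \<beta> \<in> TM M x" for \<alpha> \<beta>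
  proof -
    have "((\<lambda>y. qmul (fst y) \<alpha>) has_derivative (\<lambda>v. qmul (fst v) \<alpha>)) (at x within M)" for \<alpha>
      by (intro bounded_linear.has_derivative[OF qmul.bounded_linear_left] has_derivative_fst has_derivative_ident)
    moreover have "((\<lambda>y. qmul (snd y) \<alpha>) has_derivative (\<lambda>v. qmul (snd v) \<alpha>)) (at x within M)" for \<alpha>
      by (intro bounded_linear.has_derivative[OF qmul.bounded_linear_left] has_derivative_snd has_derivative_ident)
    ultimately have 1: "((\<lambda>y. lframe y \<alpha> \<beta>) has_derivative (\<lambda>v. (qmul (fst v) \<alpha>, qmul (snd v) \<beta>))) (at x within M)"
      unfolding lframe_def by (intro has_derivative_Pair)
    have 2: "((\<lambda>y. 2 * (u y \<bullet> (\<alpha> - \<beta>))) has_derivative (\<lambda>v. 2 * (u' v \<bullet> (\<alpha> - \<beta>)))) (at x within M)"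
      by (intro has_derivative_mult_right has_derivative_inner_left u')
    show ?thesis
      using has_derivative_diff[OF 1 has_derivative_scaleR[OF 2 \<xi>_derivative]] that
      by (simp add: Z_def[abs_def] Z'_def[abs_def] lframe_TM_iff[OF x] zero_prod_def[symmetric])
  qed
  have tan: "frechet_derivative F (at y) (Z \<alpha> \<beta> y) = 0" if "\<alpha> $ 1 = 0" "\<beta> $ 1 = 0" "y \<in> M" "y \<in> T" for \<alpha> \<beta> y
  proof -
    let ?k = "2 * (u y \<bullet> (\<alpha> - \<beta>))"
    have "Z \<alpha> \<beta> y = lframe y (\<alpha> - ?k *\<^sub>R u y) (\<beta> - ?k *\<^sub>R (- u y))"
      unfolding Z_def \<xi>_lframe[OF that(3)] lframe_scaleR lframe_diff ..
    also have "\<dots> \<in> TM M y"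
      unfolding lframe_TM_iff[OF that(3)] using that u_imag[OF that(3)]
      by (simp add: inner_diff_right inner_add_right u_norm[OF that(3)])
    finally show ?thesis using ker that by blast
  qed
  have "frechet_derivative F (at x) (Z' \<alpha> \<beta> (Z \<alpha>' \<beta>' x) - Z' \<alpha>' \<beta>' (Z \<alpha> \<beta> x)) = 0"
    by (rule bracket_tangent[OF F(3,2) x Z'[OF X] _ _ Z'[OF Y]])
      (use X Y Zx tan lframe_TM_iff[OF x] in auto)
  then have "Z' \<alpha> \<beta> (lframe x \<alpha>' \<beta>') - Z' \<alpha>' \<beta>' (lframe x \<alpha> \<beta>) \<in> TM M x"
    using ker[OF x F(2)] Zx X Y by simp
  moreover have "Z' \<alpha> \<beta> (lframe x \<alpha>' \<beta>') - Z' \<alpha>' \<beta>' (lframe x \<alpha> \<beta>) =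
    lframe x (qmul \<alpha>' \<alpha> - qmul \<alpha> \<alpha>' - (2 * (u' (lframe x \<alpha>' \<beta>') \<bullet> (\<alpha> - \<beta>) - u' (lframe x \<alpha> \<beta>) \<bullet> (\<alpha>' - \<beta>'))) *\<^sub>R u x)
      (qmul \<beta>' \<beta> - qmul \<beta> \<beta>' + (2 * (u' (lframe x \<alpha>' \<beta>') \<bullet> (\<alpha> - \<beta>) - u' (lframe x \<alpha> \<beta>) \<bullet> (\<alpha>' - \<beta>'))) *\<^sub>R u x)"
    (is "?l = lframe x ?A ?B")
    unfolding Z'_def \<xi>_lframe[OF x]
    by (simp add: lframe_def qmul.diff_right qmul.add_right qmul.minus_right qmul.scaleR_right qmul_assoc algebra_simps)
  ultimately have "u x \<bullet> (?A - ?B) = 0" by (simp add: lframe_TM_iff[OF x])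
  then show ?thesis using u_norm[OF x] by (simp add: inner_diff_right inner_add_right)
qed

text \<open>The vector (p c, - q c) is orthogonal to the fibres and moves w = q p^-1 by -2 q c p^-1.
  For u . c = 0 the normal -2 q u p^-1 changes along it by 2 q (T c) p^-1. Hence T is the shape
  operator of the surface for that normal.\<close>

definition T :: "quat \<Rightarrow> quat" where "T c = - u' (lframe x c (- c))"

lemma linear_T: "linear T"
proof -
  have "linear (\<lambda>c. lframe x c (- c))"
    by (auto intro!: linearI simp: lframe_def qmul.add_right qmul.scaleR_right qmul.diff_right qmul.minus_right)
  then have "linear (\<lambda>c. u' (lframe x c (- c)))"
    using linear_compose[OF _ u'_lin] by (simp add: o_def)
  then show ?thesis unfolding T_def[abs_def] by (rule linear_compose_neg)
qed

lemma T_plane: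
  assumes "c $ 1 = 0" "u x \<bullet> c = 0"
  shows "T c $ 1 = 0" "u x \<bullet> T c = 0"
  using u'_tangent[of "lframe x c (- c)"] assms by (auto simp: T_def lframe_TM_iff[OF x] inner_add_right)

text \<open>For (c, - c) and (d, - d) the commutators of the two factors are equal, so they cancel
  in \<open>u'_bracket\<close> and only the symmetry of the derivative of u is left.\<close>

lemma T_symmetric:
  assumes "c $ 1 = 0" "u x \<bullet> c = 0" "d $ 1 = 0" "u x \<bullet> d = 0"
  shows "T c \<bullet> d = T d \<bullet> c"
proof -
  have "lframe x c (- c) \<in> TM M x" "lframe x d (- d) \<in> TM M x"
    using assms by (auto simp: lframe_TM_iff[OF x] inner_add_right)
  from u'_bracket[OF this] show ?thesis
    by (simp add: T_def qmul.minus_left qmul.minus_right inner_add_right)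
qed

text \<open>This is the value that makes q u p^-1 stationary along (p g, q g). As \<open>M\<close>
  is not known to contain pieces of fibres, it is obtained from \<open>u'_bracket\<close>: the
  defect t is imaginary and orthogonal to u, so (t, - t) is tangent, and pairing with it gives t . t
  = 0.\<close>

lemma u'_fibre:
  assumes a: "a $ 1 = 0"
  shows "u' (lframe x a a) = 2 *\<^sub>R qcross (u x) a"
proof -
  define t where "t = 2 *\<^sub>R qcross (u x) a - u' (lframe x a a)"
  have A: "lframe x a a \<in> TM M x" using a by (simp add: lframe_TM_iff[OF x])
  have t: "t $ 1 = 0" "u x \<bullet> t = 0"
    using u'_tangent[OF A] qcross_orthogonal[OF u_imag[OF x] a] by (auto simp: t_def inner_diff_right)
  have "lframe x t (- t) \<in> TM M x"
    unfolding lframe_TM_iff[OF x] using t by (simp add: inner_add_right)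
  from u'_bracket[OF A this]
  have "u x \<bullet> (qmul t a - qmul a t) = - (u' (lframe x a a) \<bullet> t)"
    by (simp add: qmul.minus_left qmul.minus_right inner_add_right inner_diff_right)
  moreover have "u x \<bullet> (qmul z a - qmul a z) = - ((2 *\<^sub>R qcross (u x) a) \<bullet> z)" if "z $ 1 = 0" for z
    using that a u_imag[OF x] by (simp add: inner_quat qcross_def qmul_def algebra_simps)
  ultimately have "(2 *\<^sub>R qcross (u x) a - u' (lframe x a a)) \<bullet> t = 0" using t(1) by (simp add: inner_diff_left)
  then have "t = 0" unfolding t_def[symmetric] by simp
  then show ?thesis by (simp add: t_def)
qed

lemma u'_split:
  assumes "a $ 1 = 0"
  shows "u' (lframe x (a + c) (a - c)) = 2 *\<^sub>R qcross (u x) a - T c"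
proof -
  have "lframe x (a + c) (a - c) = lframe x a a + lframe x c (- c)"
    by (simp add: lframe_def qmul.add_right qmul.diff_right qmul.minus_right)
  then show ?thesis using u'_fibre[OF assms] by (simp add: linear_add[OF u'_lin] T_def)
qed

text \<open>The coefficient 1/3 is 2 - 5/3: the derivative of u along the fibre contributes -2 times
  the product of a and u, the connection 5/3 times it, and the shape operator reverses the
  sign.\<close>

lemma shapeop_split:
  assumes "a $ 1 = 0" "c $ 1 = 0" "u x \<bullet> c = 0"
  shows "shapeop M \<xi> x (lframe x (a + c) (a - c)) =
    lframe x (- qcross c (u x) + (T c + (1/3) *\<^sub>R qcross a (u x))) (- qcross c (u x) - (T c + (1/3) *\<^sub>R qcross a (u x)))"
proof -
  have "qcross (u x) a = - qcross a (u x)" by (simp add: qcross_def algebra_simps)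
  then have e: "u' (lframe x (a + c) (a - c)) + (5/3) *\<^sub>R qcross a (u x) = - (T c + (1/3) *\<^sub>R qcross a (u x))"
    unfolding u'_split[OF assms(1)] by (simp add: vec_eq_iff)
  show ?thesis unfolding shapeop_lframe[OF assms] e lframe_minus
    by (simp add: lframe_inject[OF M_NK[OF x]] algebra_simps)
qed

text \<open>The first component of the eigenvalue equation forces a = -(1/l) c \<times> u. As (c
  \<times> u) \<times> u = - c/4, the second then reads s + 1/(12 l) = l.\<close>

lemma principal_curvature_of_eigenvalue:
  assumes c: "c $ 1 = 0" "u x \<bullet> c = 0" "c \<noteq> 0" "T c = s *\<^sub>R c" and l: "l\<^sup>2 - s * l = 1/12"
  shows "l \<in> principal_curvatures M \<xi> x"
proof -
  have l0: "l \<noteq> 0" using l by auto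
  define a where "a = - (1 / l) *\<^sub>R qcross c (u x)"
  have a: "a $ 1 = 0" by (simp add: a_def)
  have cr: "qcross a (u x) = (1 / (4 * l)) *\<^sub>R c"
  proof -
    have "qcross a (u x) = - (1 / l) *\<^sub>R qcross (qcross c (u x)) (u x)"
      by (simp only: a_def qcross_scaleR)
    then show ?thesis using qcross_qcross[OF c(1) u_imag[OF x] c(2)] u_norm[OF x] by simp
  qed
  have s: "s + 1 / (12 * l) = l" using l l0 by (simp add: field_simps power2_eq_square)
  have "T c + (1/3) *\<^sub>R qcross a (u x) = (s + 1 / (12 * l)) *\<^sub>R c"
    by (simp add: c(4) cr scaleR_add_left)
  moreover have "- qcross c (u x) = l *\<^sub>R a" using l0 by (simp add: a_def)
  ultimately have "shapeop M \<xi> x (lframe x (a + c) (a - c)) = l *\<^sub>R lframe x (a + c) (a - c)"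
    unfolding shapeop_split[OF a c(1,2)] lframe_scaleR s by (simp add: algebra_simps)
  moreover have "lframe x (a + c) (a - c) \<in> TM M x"
    using a c by (simp add: lframe_TM_iff[OF x] inner_add_right)
  moreover have "lframe x (a + c) (a - c) \<noteq> 0"
  proof
    assume "lframe x (a + c) (a - c) = 0"
    then have "a + c = 0" "a - c = 0" using lframe_inject[OF M_NK[OF x], of _ _ 0 0] by (auto simp: lframe_0)
    then show False using c(3) by (simp add: vec_eq_iff)
  qed
  ultimately show ?thesis unfolding principal_curvatures_def by blast
qed

lemma T_umbilic:
  assumes card: "card (principal_curvatures M \<xi> x) = 3"
  obtains s where "\<And>c. c $ 1 = 0 \<Longrightarrow> u x \<bullet> c = 0 \<Longrightarrow> T c = s *\<^sub>R c"
proof -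
  obtain f1 f2 where f: "f1 $ 1 = 0" "f2 $ 1 = 0" "u x \<bullet> f1 = 0" "u x \<bullet> f2 = 0"
    "f1 \<bullet> f1 = 1" "f2 \<bullet> f2 = 1" "f1 \<bullet> f2 = 0"
    "\<forall>c. c $ 1 = 0 \<longrightarrow> u x \<bullet> c = 0 \<longrightarrow> c = (c \<bullet> f1) *\<^sub>R f1 + (c \<bullet> f2) *\<^sub>R f2"
    by (rule orthonormal_pair[OF u_imag[OF x] u_norm[OF x]])
  define A B C where "A = T f1 \<bullet> f1" and "B = T f1 \<bullet> f2" and "C = T f2 \<bullet> f2"
  have T1: "T f1 = A *\<^sub>R f1 + B *\<^sub>R f2"
    unfolding A_def B_def by (rule f(8)[rule_format]) (use T_plane f in auto)
  have T2: "T f2 = B *\<^sub>R f1 + C *\<^sub>R f2"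
    unfolding B_def C_def T_symmetric[OF f(1,3) f(2,4)] by (rule f(8)[rule_format]) (use T_plane f in auto)
  have "B = 0 \<and> A = C"
  proof (rule ccontr)
    assume "\<not> (B = 0 \<and> A = C)"
    then have ne: "B \<noteq> 0 \<or> A \<noteq> C" by blast
    obtain s1 s2 x1 y1 x2 y2 where s: "s1 \<noteq> s2"
    "x1 *\<^sub>R f1 + y1 *\<^sub>R f2 \<noteq> 0" "T (x1 *\<^sub>R f1 + y1 *\<^sub>R f2) = s1 *\<^sub>R (x1 *\<^sub>R f1 + y1 *\<^sub>R f2)"
    "x2 *\<^sub>R f1 + y2 *\<^sub>R f2 \<noteq> 0" "T (x2 *\<^sub>R f1 + y2 *\<^sub>R f2) = s2 *\<^sub>R (x2 *\<^sub>R f1 + y2 *\<^sub>R f2)"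
      by (rule symmetric_plane_eigenvectors[OF linear_T f(5-7) T1 T2 ne])
    \<comment> \<open>The square root of the discriminant of \<lambda>^2 - s \<lambda> -
      1/12.\<close>
    define D where "D s = sqrt (s\<^sup>2 + 1/3)" for s :: real
    have D: "(D s)\<^sup>2 = s\<^sup>2 + 1/3" "D s > 0" for s by (auto simp: D_def add_nonneg_pos)
    let ?p = "\<lambda>s. (s + D s) / 2" and ?m = "\<lambda>s. (s - D s) / 2"
    have root: "(?p s)\<^sup>2 - s * ?p s = 1/12" "(?m s)\<^sup>2 - s * ?m s = 1/12" for s
      using D(1)[of s] by (auto simp: power2_eq_square field_simps)
    have "?p s1 \<in> principal_curvatures M \<xi> x" "?m s1 \<in> principal_curvatures M \<xi> x"
      "?p s2 \<in> principal_curvatures M \<xi> x" "?m s2 \<in> principal_curvatures M \<xi> x"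
      using principal_curvature_of_eigenvalue[OF _ _ s(2,3) root(1)] principal_curvature_of_eigenvalue[OF _ _ s(2,3) root(2)]
        principal_curvature_of_eigenvalue[OF _ _ s(4,5) root(1)] principal_curvature_of_eigenvalue[OF _ _ s(4,5) root(2)] f(1-4)
      by (simp_all add: inner_add_right)
    then have "{?p s1, ?m s1, ?p s2, ?m s2} \<subseteq> principal_curvatures M \<xi> x" by simp
    \<comment> \<open>Infinite sets have \<open>card\<close> 0, so the value 3 also yields
      finiteness.\<close>
    moreover have "finite (principal_curvatures M \<xi> x)" using card card.infinite by fastforce
    ultimately have "card {?p s1, ?m s1, ?p s2, ?m s2} \<le> 3" using card card_mono by metis
    moreover have sep: "l \<noteq> l'" if "l\<^sup>2 - s1 * l = 1/12" "l'\<^sup>2 - s2 * l' = 1/12" for l l'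
    proof
      assume eq: "l = l'"
      have "s1 * l = s2 * l" using that(1) that(2)[folded eq] by linarith
      moreover have "l \<noteq> 0" using that(1) by auto
      ultimately show False using s(1) by simp
    qed
    have "?p s1 \<noteq> ?m s1" "?p s2 \<noteq> ?m s2" using D(2)[of s1] D(2)[of s2] by auto
    then have "card {?p s1, ?m s1, ?p s2, ?m s2} = 4"
      using sep[OF root(1) root(1)] sep[OF root(1) root(2)] sep[OF root(2) root(1)] sep[OF root(2) root(2)] by auto
    ultimately show False by simp
  qed
  then have "T c = A *\<^sub>R c" if "c $ 1 = 0" "u x \<bullet> c = 0" for c
  proof -
    have "T c = T ((c \<bullet> f1) *\<^sub>R f1 + (c \<bullet> f2) *\<^sub>R f2)" using f(8)[rule_format, OF that] by simp
    also have "\<dots> = A *\<^sub>R ((c \<bullet> f1) *\<^sub>R f1 + (c \<bullet> f2) *\<^sub>R f2)"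
      using \<open>B = 0 \<and> A = C\<close> T1 T2 by (simp add: linear_add[OF linear_T] linear_scale[OF linear_T] algebra_simps)
    finally show ?thesis using f(8)[rule_format, OF that] by simp
  qed
  then show ?thesis using that by blast
qed

end

end

section \<open>The umbilic surface\<close>

text \<open>Using \<open>qcnj\<close> instead of \<open>qinv\<close> keeps the map polynomial on the
  whole ambient space; the two agree on \<open>NK\<close>.\<close>

definition quo :: "quat \<times> quat \<Rightarrow> quat" where
  "quo y = qmul (snd y) (qcnj (fst y))"

definition dquo :: "quat \<times> quat \<Rightarrow> quat \<times> quat \<Rightarrow> quat" where
  "dquo y v = qmul (snd y) (qcnj (fst v)) + qmul (snd v) (qcnj (fst y))"

lemma has_derivative_quo: "(quo has_derivative dquo y) (at y within S)"
  unfolding quo_def[abs_def] dquo_def[abs_def]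
  by (intro qmul.FDERIV has_derivative_qcnj has_derivative_fst has_derivative_snd has_derivative_ident)

lemma bounded_linear_dquo: "bounded_linear (dquo y)"
  using has_derivative_quo by (rule has_derivative_bounded_linear)

lemma continuous_on_dquo: "continuous_on S (\<lambda>y. dquo y v)"
  unfolding dquo_def
  by (intro continuous_intros qmul.continuous_on continuous_on_compose2[OF bounded_linear.continuous_on[OF bounded_linear_qcnj continuous_on_id]]) auto

lemma quo_S3: "y \<in> NK \<Longrightarrow> quo y \<in> S3"
  by (auto simp: quo_def NK_S3 qmul_S3 qcnj_S3)

lemma dquo_lframe:
  "\<alpha> $ 1 = 0 \<Longrightarrow> dquo y (lframe y \<alpha> \<beta>) = qmul (qmul (snd y) (\<beta> - \<alpha>)) (qcnj (fst y))"
  by (simp add: dquo_def lframe_def qcnj_qmul qcnj_imag qmul_assoc qmul.minus_left qmul.minus_right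
    qmul.diff_left qmul.diff_right)

context PNK_hypersurface
begin

text \<open>The hypersurface is foliated by open parts of the fibres of \<open>quo\<close>, which maps it to a surface in the
  unit sphere with unit normal \<open>Nf\<close>.\<close>

definition Nf :: "quat \<times> quat \<Rightarrow> quat" where
  "Nf y = (-2) *\<^sub>R qmul (qmul (snd y) (u y)) (qcnj (fst y))"

lemma Nf_quo:
  assumes y: "y \<in> M"
  shows "Nf y \<bullet> Nf y = 1" "Nf y \<bullet> quo y = 0"
proof -
  note S = NK_S3[OF M_NK[OF y]]
  show "Nf y \<bullet> Nf y = 1"
    using S u_norm[OF y] by (simp add: Nf_def inner_qmul_right_S3 qcnj_S3 inner_qmul_left_S3)
  have "qmul (snd y) (u y) \<bullet> snd y = qmul (snd y) (u y) \<bullet> qmul (snd y) (qreal 1)" by simp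
  also have "\<dots> = 0" using u_imag[OF y] unfolding inner_qmul_left_S3[OF S(2)] by (simp add: inner_quat qreal_def)
  finally show "Nf y \<bullet> quo y = 0"
    using S by (simp add: Nf_def quo_def inner_qmul_right_S3 qcnj_S3)
qed

text \<open>In the derivative of \<open>Nf\<close> the fibre part of u' cancels the commutator of a
  and u, and c u + u c = 0 by orthogonality, which leaves a multiple of \<open>dquo\<close>. An
  eigenvalue of \<open>T\<close> enters with the opposite sign.\<close>

lemma Nf_umbilic:
  assumes y: "y \<in> M" and card: "card (principal_curvatures M \<xi> y) = 3"
  obtains s N' where "(Nf has_derivative N') (at y within M)" "\<forall>v\<in>TM M y. N' v = s *\<^sub>R dquo y v"
proof -
  obtain u' where u': "(u has_derivative u') (at y within M)" using u_derivative[OF y] .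
  obtain s where s: "\<And>c. c $ 1 = 0 \<Longrightarrow> u y \<bullet> c = 0 \<Longrightarrow> T y u' c = s *\<^sub>R c"
    using T_umbilic[OF y u' card] by metis
  define N' where "N' v = (-2) *\<^sub>R (qmul (qmul (snd y) (u y)) (qcnj (fst v)) +
    qmul (qmul (snd y) (u' v) + qmul (snd v) (u y)) (qcnj (fst y)))" for v
  have "(Nf has_derivative N') (at y within M)"
    unfolding Nf_def[abs_def] N'_def[abs_def]
    by (intro has_derivative_scaleR_right qmul.FDERIV has_derivative_qcnj has_derivative_fst has_derivative_snd
      has_derivative_ident u')
  moreover have "N' v = (- s) *\<^sub>R dquo y v" if v: "v \<in> TM M y" for v
  proof -
    obtain \<alpha> \<beta> where ab: "v = lframe y \<alpha> \<beta>" "\<alpha> $ 1 = 0" "\<beta> $ 1 = 0" "u y \<bullet> (\<alpha> - \<beta>) = 0"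
      using v unfolding TM_eq[OF y] by blast
    define a c where "a = (1/2) *\<^sub>R (\<alpha> + \<beta>)" and "c = (1/2) *\<^sub>R (\<alpha> - \<beta>)"
    have ac: "\<alpha> = a + c" "\<beta> = a - c" by (simp_all add: a_def c_def vec_eq_iff field_simps)
    have a: "a $ 1 = 0" and c: "c $ 1 = 0" "u y \<bullet> c = 0" using ab by (auto simp: a_def c_def)
    have u'v: "u' v = 2 *\<^sub>R qcross (u y) a - s *\<^sub>R c"
      unfolding ab(1) ac u'_split[OF y u' a] s[OF c] ..
    have "qmul c (u y) + qmul (u y) c = 0"
      using qmul_anticommute_sum[OF c(1) u_imag[OF y]] c(2) by (simp add: inner_commute qreal_def vec_eq_iff)
    then have e: "qmul \<beta> (u y) + u' v - qmul (u y) \<alpha> = - s *\<^sub>R c"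
      unfolding u'v ac qcross_def
      by (simp add: qmul.add_left qmul.add_right qmul.diff_left qmul.diff_right algebra_simps add_eq_0_iff)
    have "N' v = (-2) *\<^sub>R qmul (qmul (snd y) (qmul \<beta> (u y) + u' v - qmul (u y) \<alpha>)) (qcnj (fst y))"
      using ab(2) unfolding N'_def ab(1)
      by (simp add: lframe_def qcnj_qmul qcnj_imag qmul_assoc qmul.minus_left qmul.minus_right
        qmul.add_left qmul.add_right qmul.diff_left qmul.diff_right)
    also have "\<dots> = (- s) *\<^sub>R qmul (qmul (snd y) ((-2) *\<^sub>R c)) (qcnj (fst y))"
      unfolding e by (simp add: qmul.scaleR_left qmul.scaleR_right qmul.minus_left qmul.minus_right)
    also have "(-2) *\<^sub>R c = \<beta> - \<alpha>" by (simp add: c_def)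
    finally show ?thesis unfolding ab(1) dquo_lframe[OF ab(2)] .
  qed
  ultimately show ?thesis using that by blast
qed

lemma TM_compose:
  assumes h: "(h has_derivative h') (at z)" and V: "open V" "z \<in> V" "\<And>w. w \<in> V \<Longrightarrow> h w \<in> M"
  shows "h' v \<in> TM M (h z)"
proof -
  have "((\<lambda>t::real. z + t *\<^sub>R v) \<longlongrightarrow> z + 0 *\<^sub>R v) (at 0)" by (intro tendsto_intros)
  then have "\<forall>\<^sub>F t::real in at 0. z + t *\<^sub>R v \<in> V" using topological_tendstoD V by force
  then obtain e where e: "e > 0" "\<And>t. t \<noteq> 0 \<Longrightarrow> \<bar>t\<bar> < e \<Longrightarrow> z + t *\<^sub>R v \<in> V"
    by (auto simp: eventually_at)
  have "h (z + t *\<^sub>R v) \<in> M" if "t \<in> {-e<..<e}" for t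
    using e(2)[of t] that V by (cases "t = 0") auto
  moreover have "((\<lambda>t. h (z + t *\<^sub>R v)) has_vector_derivative h' v) (at 0)"
  proof -
    have "((\<lambda>t. z + t *\<^sub>R v) has_derivative (\<lambda>t. t *\<^sub>R v)) (at 0)" by (auto intro!: derivative_eq_intros)
    from has_derivative_compose[OF this, of h h'] h has_derivative_linear[OF h]
    show ?thesis by (simp add: has_vector_derivative_def linear_scale)
  qed
  ultimately show ?thesis unfolding TM_def using e(1)
    by (intro CollectI exI[of _ "\<lambda>t. h (z + t *\<^sub>R v)"] exI[of _ e]) auto
qed

text \<open>Near \<open>x\<close>, two coordinates of \<open>quo\<close> are part of a chart of \<open>M\<close>.\<close>

lemma adapted_chart:
  assumes x: "x \<in> M"
  obtains e1 e2 l1 l2 b1 b2 z0 \<rho> h h' W \<Phi> where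
    "bounded_linear l1" "bounded_linear l2" "l1 b1 = 1" "l1 b2 = 0" "l2 b1 = 0" "l2 b2 = (1::real)" "\<rho> > 0"
    "\<forall>z\<in>ball z0 \<rho>. (h has_derivative h' z) (at z) \<and> h z \<in> M \<and> e1 \<bullet> quo (h z) = l1 z \<and> e2 \<bullet> quo (h z) = l2 z"
    "open W" "x \<in> W" "continuous_on W \<Phi>" "\<Phi> x = z0" "\<forall>y\<in>M \<inter> W. \<Phi> y \<in> ball z0 \<rho> \<longrightarrow> h (\<Phi> y :: quat \<times> quat) = y"
proof -
  obtain S F where F: "open S" "x \<in> S" "smooth_on S (F :: quat \<times> quat \<Rightarrow> real^3)"
    "\<forall>y\<in>S. surj (frechet_derivative F (at y))" "M \<inter> S = {y\<in>S. F y = 0}"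
    by (rule local_equation[OF x])
  obtain F' where F': "\<And>y. y \<in> S \<Longrightarrow> (F has_derivative blinfun_apply (F' y)) (at y)"
    "continuous_on S F'" "\<And>y. y \<in> S \<Longrightarrow> blinfun_apply (F' y) = frechet_derivative F (at y)"
    using smooth_on_blinfun_derivative[OF F(3)] by metis
  have ker: "F' x v = 0" if "v \<in> TM M x" for v
    using that TM_eq_kernel[OF F(1,2) x F(3) F(4)[rule_format, OF F(2)] F(5)] F'(3)[OF F(2)] by simp
  have lin: "linear (blinfun_apply (F' x))"
    by (simp add: blinfun.bounded_linear_right bounded_linear.linear)
  obtain B0 where B0: "linear B0" "\<And>z. F' x (B0 z) = z"
    using linear_surjective_right_inverse[OF lin] F(4) F'(3) F(2) by (auto simp: fun_eq_iff)
  obtain f1 f2 where f: "f1 $ 1 = 0" "f2 $ 1 = 0" "u x \<bullet> f1 = 0" "u x \<bullet> f2 = 0"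
    "f1 \<bullet> f1 = 1" "f2 \<bullet> f2 = 1" "f1 \<bullet> f2 = 0"
    "\<forall>c. c $ 1 = 0 \<longrightarrow> u x \<bullet> c = 0 \<longrightarrow> c = (c \<bullet> f1) *\<^sub>R f1 + (c \<bullet> f2) *\<^sub>R f2"
    by (rule orthonormal_pair[OF u_imag[OF x] u_norm[OF x]])
  \<comment> \<open>\<open>ee\<close> maps the plane orthogonal to u isometrically onto the tangent
    plane of the surface, and \<open>t f\<close> is the lift of \<open>ee f\<close> orthogonal to
    the fibres.\<close>
  define ee where "ee f = qmul (qmul (snd x) f) (qcnj (fst x))" for f
  define t where "t f = lframe x (- (1/2) *\<^sub>R f) ((1/2) *\<^sub>R f)" for f
  have ee: "ee f \<bullet> ee g = f \<bullet> g" for f g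
    using NK_S3[OF M_NK[OF x]] by (simp add: ee_def inner_qmul_right_S3 qcnj_S3 inner_qmul_left_S3)
  have dt: "dquo x (t f) = ee f" if "f $ 1 = 0" for f
  proof -
    have "(1/2) *\<^sub>R f - - (1/2) *\<^sub>R f = f" by (simp add: vec_eq_iff)
    then show ?thesis unfolding t_def using that by (subst dquo_lframe) (auto simp: ee_def)
  qed
  have tT: "F' x (t f) = 0" if "f $ 1 = 0" "u x \<bullet> f = 0" for f
    using that by (intro ker) (simp add: t_def lframe_TM_iff[OF x] inner_diff_right)
  \<comment> \<open>Joining two coordinates of \<open>quo\<close> to the equations of
    \<open>M\<close> gives a submersion whose chart straightens \<open>M\<close> and makes these
    coordinates linear at the same time.\<close>
  define H where "H y = (F y, ee f1 \<bullet> quo y, ee f2 \<bullet> quo y)" for y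
  define DH where "DH y v = (F' y v, ee f1 \<bullet> dquo y v, ee f2 \<bullet> dquo y v)" for y v
  define H' where "H' y = Blinfun (DH y)" for y
  have DH: "(H has_derivative DH y) (at y)" if "y \<in> S" for y
    unfolding H_def[abs_def] DH_def[abs_def]
    by (intro has_derivative_Pair F'(1) that has_derivative_inner_right has_derivative_quo)
  have H'app: "blinfun_apply (H' y) = DH y" if "y \<in> S" for y
    unfolding H'_def using DH[OF that] by (simp add: bounded_linear_Blinfun_apply has_derivative_bounded_linear)
  have H': "(H has_derivative blinfun_apply (H' y)) (at y)" if "y \<in> S" for y
    using DH[OF that] H'app[OF that] by simp
  have "continuous_on S (\<lambda>y. DH y v)" for v
    unfolding DH_def by (intro continuous_intros F'(2) continuous_on_dquo)
  then have "continuous_on S (\<lambda>y. blinfun_apply (H' y) v)" for v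
    by (simp add: H'app cong: continuous_on_cong)
  then have cH: "continuous_on S H'" by (intro continuous_on_blinfun_componentwise)
  interpret dq: bounded_linear "dquo x" by (rule bounded_linear_dquo)
  \<comment> \<open>\<open>B0\<close> solves for the first component; multiples of
    \<open>t f1\<close> and \<open>t f2\<close>, which lie in the kernel of \<open>F' x\<close>,
    then correct the other two.\<close>
  define B where "B z = B0 (fst z) + (fst (snd z) - ee f1 \<bullet> dquo x (B0 (fst z))) *\<^sub>R t f1
    + (snd (snd z) - ee f2 \<bullet> dquo x (B0 (fst z))) *\<^sub>R t f2" for z
  have linB: "linear B"
    by (auto intro!: linearI simp: B_def linear_add[OF B0(1)] linear_scale[OF B0(1)] dq.add dq.scaleR
      inner_add_right algebra_simps)
  have DHB: "DH x (B z) = z" for z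
    using f by (simp add: DH_def B_def blinfun.add_right blinfun.scaleR_right B0 tT dq.add dq.scaleR dt
      inner_add_right ee inner_commute[of f2 f1])
  have LB: "H' x (B z) = z" for z using DHB H'app[OF F(2)] by simp
  obtain U V \<Phi> g g' where C: "open U" "x \<in> U" "U \<subseteq> S" "open V" "homeomorphism U V \<Phi> g"
    "\<And>y. y \<in> U \<Longrightarrow> H' x (\<Phi> y) = H y" "\<And>z. z \<in> V \<Longrightarrow> (g has_derivative g' z) (at z)" "g' (\<Phi> x) = id"
    using submersion_chart[where H = H, OF F(1,2) H' cH linB LB] by metis
  note hm = C(5)[unfolded homeomorphism_def]
  \<comment> \<open>Projection onto the kernel of \<open>F' x\<close>. With it the parametrisation
    of \<open>M\<close> is defined on an open ball of the full space, so derivatives need not be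
    restricted to a subspace.\<close>
  define \<pi> where "\<pi> z = z - B (fst (H' x z), 0, 0)" for z
  have bl\<pi>: "bounded_linear \<pi>"
    unfolding linear_conv_bounded_linear[symmetric]
  proof (rule linearI)
    have *: "B (a + b, 0, 0) = B (a, 0, 0) + B (b, 0, 0)" "B (k *\<^sub>R a, 0, 0) = k *\<^sub>R B (a, 0, 0)" for a b k
      using linear_add[OF linB, of "(a, 0, 0)" "(b, 0, 0)"] linear_scale[OF linB, of k "(a, 0, 0)"] by simp_all
    show "\<pi> (a + b) = \<pi> a + \<pi> b" "\<pi> (k *\<^sub>R a) = k *\<^sub>R \<pi> a" for a b k
      by (simp_all add: \<pi>_def blinfun.add_right blinfun.scaleR_right * algebra_simps)
  qed
  have L\<pi>: "H' x (\<pi> z) = (0, snd (H' x z))" for z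
    by (simp add: \<pi>_def blinfun.diff_right LB prod_eq_iff)
  have H0: "fst (H y) = 0" if "y \<in> M" "y \<in> S" for y using that F(5) by (auto simp: H_def)
  define z0 where "z0 = \<Phi> x"
  have "(0, 0, 0) = (0 :: (real^3) \<times> real \<times> real)" by (simp add: zero_prod_def)
  then have B00: "B (0, 0, 0) = 0" using linear_0[OF linB] by simp
  have \<pi>_fix: "\<pi> (\<Phi> y) = \<Phi> y" if "y \<in> M" "y \<in> U" for y
  proof -
    have "y \<in> S" using C(3) that(2) by blast
    then show ?thesis using C(6)[OF that(2)] H0[OF that(1)] B00 by (simp add: \<pi>_def)
  qed
  have z0: "\<pi> z0 = z0" "z0 \<in> V"
    using \<pi>_fix[OF x C(2)] hm C(2) by (auto simp: z0_def)
  have "open (\<pi> -` V)" using C(4) bl\<pi> by (intro open_vimage linear_continuous_on)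
  then obtain \<rho> where \<rho>: "\<rho> > 0" "ball z0 \<rho> \<subseteq> \<pi> -` V" using z0 openE by (metis vimageI)
  have \<pi>V: "\<pi> z \<in> V" if "z \<in> ball z0 \<rho>" for z using that \<rho> by blast
  let ?l1 = "\<lambda>z. fst (snd (H' x z))" and ?l2 = "\<lambda>z. snd (snd (H' x z))"
  show ?thesis
  proof (rule that[of ?l1 ?l2 "B (0, 1, 0)" "B (0, 0, 1)" \<rho> z0 "\<lambda>z. g (\<pi> z)" "\<lambda>z v. g' (\<pi> z) (\<pi> v)" "ee f1" "ee f2" U \<Phi>])
    show "bounded_linear ?l1" "bounded_linear ?l2"
      using bounded_linear_compose[OF bounded_linear_fst bounded_linear_compose[OF bounded_linear_snd blinfun.bounded_linear_right]]
        bounded_linear_compose[OF bounded_linear_snd bounded_linear_compose[OF bounded_linear_snd blinfun.bounded_linear_right]] by auto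
    show "\<forall>z\<in>ball z0 \<rho>. ((\<lambda>z. g (\<pi> z)) has_derivative (\<lambda>v. g' (\<pi> z) (\<pi> v))) (at z) \<and> g (\<pi> z) \<in> M \<and>
      ee f1 \<bullet> quo (g (\<pi> z)) = ?l1 z \<and> ee f2 \<bullet> quo (g (\<pi> z)) = ?l2 z"
    proof
      fix z assume z: "z \<in> ball z0 \<rho>"
      have U: "g (\<pi> z) \<in> U" "\<Phi> (g (\<pi> z)) = \<pi> z" using hm \<pi>V[OF z] by auto
      then have "H (g (\<pi> z)) = (0, snd (H' x z))" using C(6)[OF U(1)] L\<pi> by simp
      then have "F (g (\<pi> z)) = 0" "ee f1 \<bullet> quo (g (\<pi> z)) = ?l1 z" "ee f2 \<bullet> quo (g (\<pi> z)) = ?l2 z"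
        by (auto simp: H_def prod_eq_iff)
      moreover have "((\<lambda>z. g (\<pi> z)) has_derivative (\<lambda>v. g' (\<pi> z) (\<pi> v))) (at z)"
        by (rule has_derivative_compose[OF bounded_linear_imp_has_derivative[OF bl\<pi>] C(7)[OF \<pi>V[OF z]]])
      ultimately show "((\<lambda>z. g (\<pi> z)) has_derivative (\<lambda>v. g' (\<pi> z) (\<pi> v))) (at z) \<and> g (\<pi> z) \<in> M \<and>
        ee f1 \<bullet> quo (g (\<pi> z)) = ?l1 z \<and> ee f2 \<bullet> quo (g (\<pi> z)) = ?l2 z"
        using F(5) U(1) C(3) by blast
    qed
    show "\<forall>y\<in>M \<inter> U. \<Phi> y \<in> ball z0 \<rho> \<longrightarrow> g (\<pi> (\<Phi> y)) = y"
    proof (intro ballI impI)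
      fix y assume y: "y \<in> M \<inter> U"
      then have "\<pi> (\<Phi> y) = \<Phi> y" by (intro \<pi>_fix) auto
      then show "g (\<pi> (\<Phi> y)) = y" using hm y by auto
    qed
    show "continuous_on U \<Phi>" using hm by blast
  qed (simp_all add: LB \<rho>(1) C(1,2) z0_def)
qed

text \<open>In the chart, the normal and \<open>quo\<close> have proportional derivatives with a
  factor that is constant near the centre. Their combination has derivative zero on a convex ball
  and is therefore a fixed vector.\<close>

lemma local_sphere:
  assumes x: "x \<in> M" and card: "\<And>y. y \<in> M \<Longrightarrow> card (principal_curvatures M \<xi> y) = 3"
  obtains W k s where "open W" "x \<in> W" "\<forall>y\<in>M \<inter> W. Nf y = k + s *\<^sub>R quo y"
proof -
  obtain e1 e2 l1 l2 b1 b2 z0 \<rho> h h' W \<Phi> where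
    l: "bounded_linear l1" "bounded_linear l2" "l1 b1 = 1" "l1 b2 = 0" "l2 b1 = 0" "l2 b2 = (1::real)" and \<rho>: "\<rho> > 0"
    and h: "\<forall>z\<in>ball z0 \<rho>. (h has_derivative h' z) (at z) \<and> h z \<in> M \<and> e1 \<bullet> quo (h z) = l1 z \<and> e2 \<bullet> quo (h z) = l2 z"
    and W: "open W" "x \<in> W" "continuous_on W \<Phi>" "\<Phi> x = z0" "\<forall>y\<in>M \<inter> W. \<Phi> y \<in> ball z0 \<rho> \<longrightarrow> h (\<Phi> y :: quat \<times> quat) = y"
    by (rule adapted_chart[OF x])
  have "\<forall>y\<in>M. \<exists>s N'. (Nf has_derivative N') (at y within M) \<and> (\<forall>v\<in>TM M y. N' v = s *\<^sub>R dquo y v)"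
    using Nf_umbilic card by metis
  then obtain s N' where N': "\<And>y. y \<in> M \<Longrightarrow> (Nf has_derivative N' y) (at y within M)"
    "\<And>y v. y \<in> M \<Longrightarrow> v \<in> TM M y \<Longrightarrow> N' y v = s y *\<^sub>R dquo y v" by metis
  define \<psi>' where "\<psi>' z v = dquo (h z) (h' z v)" for z v
  have \<psi>: "((\<lambda>z. quo (h z)) has_derivative \<psi>' z) (at z)" if "z \<in> ball z0 \<rho>" for z
    unfolding \<psi>'_def using h that by (intro has_derivative_compose[OF _ has_derivative_quo]) auto
  have \<nu>: "((\<lambda>z. Nf (h z)) has_derivative (\<lambda>v. s (h z) *\<^sub>R \<psi>' z v)) (at z)" if z: "z \<in> ball z0 \<rho>" for z
  proof -
    have hz: "(h has_derivative h' z) (at z within ball z0 \<rho>)" "h z \<in> M" "(h has_derivative h' z) (at z)"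
      using h z by (auto intro: has_derivative_at_withinI)
    have "(Nf has_derivative N' (h z)) (at (h z) within h ` ball z0 \<rho>)"
      using N'(1)[OF hz(2)] by (rule has_derivative_subset) (use h in auto)
    from has_derivative_in_compose[OF hz(1) this]
    have "((\<lambda>z. Nf (h z)) has_derivative (\<lambda>v. N' (h z) (h' z v))) (at z)"
      using at_within_open[OF z open_ball] by simp
    moreover have "N' (h z) (h' z v) = s (h z) *\<^sub>R \<psi>' z v" for v
      unfolding \<psi>'_def by (rule N'(2)[OF hz(2) TM_compose[OF hz(3) open_ball z]]) (use h in auto)
    ultimately show ?thesis by simp
  qed
  have lv: "e \<bullet> \<psi>' z v = l v" if z: "z \<in> ball z0 \<rho>" and e: "\<forall>z\<in>ball z0 \<rho>. e \<bullet> quo (h z) = l z" and "bounded_linear l" for z v e l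
  proof -
    have "((\<lambda>z. e \<bullet> quo (h z)) has_derivative (\<lambda>v. e \<bullet> \<psi>' z v)) (at z)"
      by (rule has_derivative_inner_right[OF \<psi>[OF z]])
    then have "(l has_derivative (\<lambda>v. e \<bullet> \<psi>' z v)) (at z)"
      by (rule has_derivative_transform_within_open[OF _ open_ball z]) (use e in auto)
    with bounded_linear_imp_has_derivative[OF \<open>bounded_linear l\<close>] show ?thesis
      by (metis has_derivative_unique)
  qed
  have lv1: "e1 \<bullet> \<psi>' z v = l1 v" and lv2: "e2 \<bullet> \<psi>' z v = l2 v" if "z \<in> ball z0 \<rho>" for z v
    using lv[OF that _ l(1), of e1] lv[OF that _ l(2), of e2] h by auto
  obtain \<delta> where \<delta>: "0 < \<delta>" "\<delta> \<le> \<rho>" "\<And>z. z \<in> ball z0 \<delta> \<Longrightarrow> s (h z) = s (h z0)"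
    using umbilic_factor_constant[where s = "\<lambda>z. s (h z)" and \<psi>' = \<psi>' and \<nu> = "\<lambda>z. Nf (h z)", OF \<rho> \<nu> lv1 lv2 l] by metis
  define G where "G z = Nf (h z) - s (h z0) *\<^sub>R quo (h z)" for z
  have "(G has_derivative (\<lambda>v. 0)) (at z within ball z0 \<delta>)" if z: "z \<in> ball z0 \<delta>" for z
  proof -
    have z': "z \<in> ball z0 \<rho>" using z \<delta> by auto
    have "(G has_derivative (\<lambda>v. s (h z) *\<^sub>R \<psi>' z v - s (h z0) *\<^sub>R \<psi>' z v)) (at z)"
      unfolding G_def[abs_def] by (intro has_derivative_diff \<nu> has_derivative_scaleR_right \<psi> z')
    then show ?thesis using \<delta>(3)[OF z] by (auto intro: has_derivative_at_withinI)
  qed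
  then obtain k where k: "\<And>z. z \<in> ball z0 \<delta> \<Longrightarrow> G z = k"
    using has_derivative_zero_constant[OF convex_ball, of z0 \<delta> G] by blast
  show ?thesis
  proof (rule that)
    show "open (W \<inter> \<Phi> -` ball z0 \<delta>)" using W(1,3) continuous_open_preimage by blast
    show "x \<in> W \<inter> \<Phi> -` ball z0 \<delta>" using W \<delta> by auto
    show "\<forall>y\<in>M \<inter> (W \<inter> \<Phi> -` ball z0 \<delta>). Nf y = k + s (h z0) *\<^sub>R quo y"
    proof
      fix y assume y: "y \<in> M \<inter> (W \<inter> \<Phi> -` ball z0 \<delta>)"
      then have "\<Phi> y \<in> ball z0 \<rho>" using \<delta>(2) by auto
      then have "h (\<Phi> y) = y" using W(5) y by blast
      then show "Nf y = k + s (h z0) *\<^sub>R quo y" using k[of "\<Phi> y"] y by (simp add: G_def algebra_simps)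
    qed
  qed
qed

end

section \<open>Round spheres\<close>

text \<open>The point (x, y) goes to (p, w p), where p is the conjugate of x and w = sqrt (1 - r^2)
  + r y. So \<open>quo\<close> returns w and forgets x, and x runs through the whole fibre.\<close>

lemma image_F2_f_r:
  assumes r: "0 < r" "r \<le> 1"
  shows "(F2 \<circ> f_r r) ` (S3 \<times> S2) = {y \<in> NK. quo y $ 1 = sqrt (1 - r\<^sup>2)}"
proof (intro set_eqI iffI)
  have r2: "(sqrt (1 - r\<^sup>2))\<^sup>2 = 1 - r\<^sup>2" using r by (simp add: power_le_one)
  {
    fix y assume "y \<in> (F2 \<circ> f_r r) ` (S3 \<times> S2)"
    then obtain a b where ab: "a \<in> S3" "b \<in> S2" "y = F2 (f_r r (a, b))" by auto
    let ?w = "qreal (sqrt (1 - r\<^sup>2)) + r *\<^sub>R b"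
    have b: "b $ 1 = 0" "b \<bullet> b = 1" using ab(2) by (auto simp: S2_def norm_eq_1)
    have qq: "qreal k \<bullet> z = k * z $ 1" "z \<bullet> qreal k = k * z $ 1" for k z by (simp_all add: inner_quat qreal_def)
    have "?w \<bullet> ?w = (sqrt (1 - r\<^sup>2))\<^sup>2 + r\<^sup>2"
      by (simp add: inner_add_left inner_add_right qq b power2_eq_square)
    then have w: "?w \<in> S3" by (simp add: S3_inner r2)
    have "y = (qcnj a, qmul ?w (qcnj a))" by (simp add: ab(3) F2_def f_r_def)
    moreover from this have "quo y = ?w" using ab(1) by (simp add: quo_def S3_cancel)
    ultimately show "y \<in> {y \<in> NK. quo y $ 1 = sqrt (1 - r\<^sup>2)}"
      using w ab(1) b by (auto simp: NK_def qcnj_S3 qmul_S3)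
  next
    fix y assume "y \<in> {y \<in> NK. quo y $ 1 = sqrt (1 - r\<^sup>2)}"
    then have y: "y \<in> NK" "quo y $ 1 = sqrt (1 - r\<^sup>2)" by auto
    note S = NK_S3[OF y(1)]
    define b where "b = (1 / r) *\<^sub>R (quo y - qreal (sqrt (1 - r\<^sup>2)))"
    have q: "quo y = qreal (sqrt (1 - r\<^sup>2)) + r *\<^sub>R b" using r by (simp add: b_def)
    have b1: "b $ 1 = 0" using y by (simp add: b_def)
    have qq: "qreal k \<bullet> z = k * z $ 1" "z \<bullet> qreal k = k * z $ 1" for k z by (simp_all add: inner_quat qreal_def)
    have "1 = quo y \<bullet> quo y" using quo_S3[OF y(1)] by (simp add: S3_inner)
    also have "\<dots> = (sqrt (1 - r\<^sup>2))\<^sup>2 + r\<^sup>2 * (b \<bullet> b)"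
      unfolding q by (simp add: inner_add_left inner_add_right qq b1 power2_eq_square)
    also have "\<dots> = (1 - r\<^sup>2) + r\<^sup>2 * (b \<bullet> b)" unfolding r2 ..
    finally have "b \<bullet> b = 1" using r by simp
    then have "b \<in> S2" using b1 by (simp add: S2_def norm_eq_1)
    moreover have "F2 (f_r r (qcnj (fst y), b)) = y"
    proof -
      have "F2 (f_r r (qcnj (fst y), b)) = (fst y, qmul (quo y) (fst y))"
        by (simp add: F2_def f_r_def q)
      also have "\<dots> = y" using S by (simp add: quo_def S3_cancel)
      finally show ?thesis .
    qed
    ultimately show "y \<in> (F2 \<circ> f_r r) ` (S3 \<times> S2)" using qcnj_S3[OF S(1)] by force
  }
qed

text \<open>The preimage of the sphere is also the zero set of three functions, regular because k <
  1 keeps \<open>quo x\<close> away from the poles m and -m. Thus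
  \<open>level_set_inclusion_open\<close> applies at each point.\<close>

lemma sphere_bundle_open:
  assumes hyp: "hypersurface_NK M" and W: "open W" and m: "m \<in> S3" and k: "0 \<le> k" "k < 1"
    and sub: "\<forall>y\<in>M \<inter> W. m \<bullet> quo y = k"
  shows "openin (top_of_set {y \<in> NK. m \<bullet> quo y = k}) (M \<inter> W)"
proof -
  let ?E = "{y \<in> NK. m \<bullet> quo y = k}"
  have MN: "M \<subseteq> NK" using hyp by (simp add: hypersurface_NK_def)
  have nbhd: "\<exists>T. open T \<and> x \<in> T \<and> ?E \<inter> T \<subseteq> M \<inter> W" if xM: "x \<in> M" "x \<in> W" for x
  proof -
    have xN: "x \<in> NK" using MN xM by blast
    have "\<exists>S (F :: quat \<times> quat \<Rightarrow> real^3). open S \<and> x \<in> S \<and> smooth_on S F \<and>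
      (\<forall>y\<in>S. surj (frechet_derivative F (at y))) \<and> M \<inter> S = {y\<in>S. F y = 0}"
      using hyp xM(1) unfolding hypersurface_NK_def by (elim conjE bspec)
    then obtain S and F :: "quat \<times> quat \<Rightarrow> real^3" where F: "open S" "x \<in> S" "smooth_on S F"
      "\<forall>y\<in>S. surj (frechet_derivative F (at y))" "M \<inter> S = {y\<in>S. F y = 0}" by (elim exE conjE)
    obtain F' where F': "\<And>y. y \<in> S \<Longrightarrow> (F has_derivative blinfun_apply (F' y)) (at y)"
      "continuous_on S F'" "\<And>y. y \<in> S \<Longrightarrow> blinfun_apply (F' y) = frechet_derivative F (at y)"
      using smooth_on_blinfun_derivative[OF F(3)] by metis
    define G where "G y = (fst y \<bullet> fst y - 1, snd y \<bullet> snd y - 1, m \<bullet> quo y - k)" for y :: "quat \<times> quat"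
    define DG where "DG y v = (2 * (fst y \<bullet> fst v), 2 * (snd y \<bullet> snd v), m \<bullet> dquo y v)" for y v :: "quat \<times> quat"
    have G0: "G y = 0 \<longleftrightarrow> y \<in> ?E" for y
      by (auto simp: G_def zero_prod_def NK_def S3_inner mem_Times_iff)
    have DG: "(G has_derivative DG y) (at y)" for y
    proof -
      have "((\<lambda>y. fst y \<bullet> fst y - 1) has_derivative (\<lambda>v. 2 * (fst y \<bullet> fst v))) (at y)"
        "((\<lambda>y. snd y \<bullet> snd y - 1) has_derivative (\<lambda>v. 2 * (snd y \<bullet> snd v))) (at y)"
        by (auto intro!: derivative_eq_intros simp: inner_commute)
      moreover have "((\<lambda>y. m \<bullet> quo y - k) has_derivative (\<lambda>v. m \<bullet> dquo y v)) (at y)"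
        using has_derivative_diff[OF has_derivative_inner_right[OF has_derivative_quo, of m y UNIV] has_derivative_const[of k]]
        by simp
      ultimately show ?thesis unfolding G_def[abs_def] DG_def[abs_def] by (intro has_derivative_Pair)
    qed
    define G' where "G' y = Blinfun (DG y)" for y
    have G'app: "blinfun_apply (G' y) = DG y" for y
      unfolding G'_def by (rule bounded_linear_Blinfun_apply[OF has_derivative_bounded_linear[OF DG]])
    have "continuous_on S (\<lambda>y. DG y v)" for v
      unfolding DG_def by (intro continuous_intros continuous_on_dquo)
    then have cG: "continuous_on S G'" by (intro continuous_on_blinfun_componentwise) (simp add: G'app)
    have surjG: "surj (blinfun_apply (G' x))"
    proof -
      note S = NK_S3[OF xN]
      have n: "fst x \<bullet> fst x = 1" "snd x \<bullet> snd x = 1" "m \<bullet> m = 1" "quo x \<bullet> quo x = 1"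
        using S m quo_S3[OF xN] by (auto simp: S3_inner)
      have mk: "m \<bullet> quo x = k" using sub xM by blast
      interpret dq: bounded_linear "dquo x" by (rule bounded_linear_dquo)
      \<comment> \<open>The part of m orthogonal to \<open>quo x\<close>, with m . z = 1 - k^2 > 0.
        Moving only the second factor by \<open>w\<close> moves \<open>quo\<close> by z and respects
        both unit-length conditions to first order.\<close>
      define z where "z = m - k *\<^sub>R quo x"
      have z: "quo x \<bullet> z = 0" "m \<bullet> z = 1 - k\<^sup>2"
        by (simp_all add: z_def inner_diff_right mk n inner_commute[of "quo x" m] power2_eq_square)
      have "k\<^sup>2 < 1" using k by (simp add: power_less_one_iff abs_square_less_1)
      define w where "w = qmul z (fst x)"
      have w: "snd x \<bullet> w = 0"
      proof -
        have "snd x \<bullet> w = w \<bullet> snd x" by (rule inner_commute)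
        also have "\<dots> = z \<bullet> quo x" by (simp add: w_def inner_qmul_right quo_def)
        finally show ?thesis using z(1) by (simp add: inner_commute)
      qed
      have dw: "dquo x (0, w) = z" using S by (simp add: dquo_def w_def S3_cancel qmul.zero_right linear_0 bounded_linear.linear[OF bounded_linear_qcnj])
      have dp: "dquo x (fst x, 0) = quo x" "dquo x (0, snd x) = quo x"
        by (simp_all add: dquo_def quo_def qmul.zero_left qmul.zero_right linear_0 bounded_linear.linear[OF bounded_linear_qcnj])
      have D: "DG x (fst x, 0) = (2, 0, k)" "DG x (0, snd x) = (0, 2, k)" "DG x (0, w) = (0, 0, 1 - k\<^sup>2)"
        by (simp_all add: DG_def dp dw n w z mk)
      have lin: "linear (DG x)" using DG by (rule has_derivative_linear)
      show ?thesis unfolding surj_def G'app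
      proof
        fix y :: "real \<times> real \<times> real"
        obtain a b c where y: "y = (a, b, c)" by (cases y)
        have "DG x ((a/2) *\<^sub>R (fst x, 0) + (b/2) *\<^sub>R (0, snd x) + ((c - (a+b)*k/2) / (1 - k\<^sup>2)) *\<^sub>R (0, w)) = y"
          using \<open>k\<^sup>2 < 1\<close> unfolding linear_add[OF lin] linear_scale[OF lin] D y by (simp add: field_simps)
        then show "\<exists>v. y = DG x v" by metis
      qed
    qed
    have surjF: "surj (blinfun_apply (F' x))" using F'(3) F(2,4) by simp
    obtain T where "open T" "x \<in> T" "T \<subseteq> S \<inter> W" "\<And>y. y \<in> T \<Longrightarrow> G y = 0 \<Longrightarrow> F y = 0"
    proof (rule level_set_inclusion_open[of "S \<inter> W" x F F' G G'])
      show "\<And>y. y \<in> S \<inter> W \<Longrightarrow> F y = 0 \<Longrightarrow> G y = 0"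
        unfolding G0 using F(5) MN sub by blast
      show "F x = 0" using F(2,5) xM by blast
    qed (use F xM W F' surjF surjG cG DG G'app in \<open>auto intro: continuous_on_subset\<close>)
    then show ?thesis using F(5) G0 by (intro exI[of _ T]) blast
  qed
  show ?thesis
  proof (subst openin_subopen, intro ballI)
    fix x assume x: "x \<in> M \<inter> W"
    then obtain T where T: "open T" "x \<in> T" "?E \<inter> T \<subseteq> M \<inter> W" using nbhd by blast
    have "x \<in> ?E" using x MN sub by blast
    then show "\<exists>T. openin (top_of_set ?E) T \<and> x \<in> T \<and> T \<subseteq> M \<inter> W"
      using T by (intro exI[of _ "?E \<inter> T"]) (simp add: openin_open_Int)
  qed
qed

theorem theorem5p3:
  fixes M :: "(quat \<times> quat) set" and \<xi> :: "quat \<times> quat \<Rightarrow> quat \<times> quat"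
  assumes "hypersurface_NK M" and "connected M" and "M \<noteq> {}"
    and "unit_normal M \<xi>"
    and "hopf M \<xi>"
    and "\<forall>x\<in>M. card (principal_curvatures M \<xi> x) = 3"
    and "\<forall>x\<in>M. PNK x ` Uperp M \<xi> x = Uperp M \<xi> x"
    and "\<forall>x\<in>M. PNK x (\<xi> x) = - \<xi> x"
  shows "\<forall>x\<in>M. \<exists>Op. open Op \<and> x \<in> Op \<and>
           (\<exists>a b c r. a \<in> S3 \<and> b \<in> S3 \<and> c \<in> S3 \<and> 0 < r \<and> r \<le> 1 \<and>
              openin (top_of_set ((F2 \<circ> f_r r) ` (S3 \<times> S2))) (Fabc a b c ` (M \<inter> Op)))"
proof
  interpret PNK_hypersurface M \<xi> using assms by unfold_locales auto
  fix x assume x: "x \<in> M"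
  obtain W k0 s where W: "open W" "x \<in> W" "\<forall>y\<in>M \<inter> W. Nf y = k0 + s *\<^sub>R quo y"
    using local_sphere[OF x] assms(6) by metis
  \<comment> \<open>Here k0 = Nf y - s w with \<open>Nf y\<close> and w = \<open>quo y\<close>
    orthonormal.\<close>
  have kq: "k0 \<bullet> quo y = - s" "k0 \<bullet> k0 = 1 + s\<^sup>2" if "y \<in> M \<inter> W" for y
  proof -
    have k0: "k0 = Nf y - s *\<^sub>R quo y" using W(3) that by auto
    have q: "quo y \<bullet> quo y = 1" using quo_S3[OF M_NK] that by (simp add: S3_inner)
    note N = Nf_quo[of y]
    show "k0 \<bullet> quo y = - s" "k0 \<bullet> k0 = 1 + s\<^sup>2"
      using that N q unfolding k0
      by (auto simp: inner_diff_left inner_diff_right inner_commute[of "quo y" "Nf y"] power2_eq_square)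
  qed
  define n where "n = sqrt (1 + s\<^sup>2)"
  have n: "n > 0" "n\<^sup>2 = 1 + s\<^sup>2" by (auto simp: n_def add_pos_nonneg)
  have "\<bar>s\<bar> < n" unfolding n_def by (rule real_less_rsqrt) simp
  \<comment> \<open>The sign makes the height k nonnegative, as it has to be a value sqrt (1 - r^2);
    since |s| < n it stays below 1, so r > 0.\<close>
  define e where "e = (if s \<le> 0 then 1 else - 1 :: real)"
  define m where "m = (e / n) *\<^sub>R k0"
  define k where "k = \<bar>s\<bar> / n"
  have k: "0 \<le> k" "k < 1" using n \<open>\<bar>s\<bar> < n\<close> by (auto simp: k_def)
  have "k0 \<bullet> k0 = n * n" using kq(2)[of x] W(2) x n by (simp add: power2_eq_square)
  then have "m \<bullet> m = 1" using n(1) by (simp add: m_def e_def)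
  then have m: "m \<in> S3" by (simp add: S3_inner)
  have sub: "\<forall>y\<in>M \<inter> W. m \<bullet> quo y = k" using kq(1) by (auto simp: m_def k_def e_def)
  define r where "r = sqrt (1 - k\<^sup>2)"
  have "k\<^sup>2 < 1" using k by (simp add: abs_square_less_1)
  then have r: "0 < r" "r \<le> 1" "sqrt (1 - r\<^sup>2) = k" using k by (auto simp: r_def)
  let ?E = "{y \<in> NK. m \<bullet> quo y = k}" and ?E' = "{y \<in> NK. quo y $ 1 = k}"
  let ?f = "Fabc (qreal 1) (qcnj m) (qreal 1)" and ?g = "Fabc (qreal 1) m (qreal 1)"
  have one: "qreal 1 \<in> S3" by (simp add: S3_inner inner_quat qreal_def)
  have f: "?f y = (fst y, qmul (qcnj m) (snd y))" "?g y = (fst y, qmul m (snd y))" for y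
    by (simp_all add: Fabc_def)
  have cont: "continuous_on S ?f" "continuous_on S ?g" for S
    unfolding f by (intro continuous_intros qmul.continuous_on)+
  have qf: "quo (?f y) $ 1 = m \<bullet> quo y" for y
    by (simp add: f quo_def qmul_assoc qmul_component1)
  have fg: "?g (?f y) = y" "?f (?g y) = y" for y using m by (simp_all add: f S3_cancel)
  have NKf: "?f y \<in> NK" "?g y \<in> NK" if "y \<in> NK" for y
    using that m by (auto simp: f NK_def qmul_S3 qcnj_S3)
  have "homeomorphism ?E ?E' ?f ?g"
  proof (rule homeomorphismI)
    show "?f ` ?E \<subseteq> ?E'" using NKf qf by auto
    show "?g ` ?E' \<subseteq> ?E" using NKf qf[of "?g _"] fg by auto
  qed (use cont fg in auto)
  then have "openin (top_of_set ?E') (?f ` (M \<inter> W))"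
    using homeomorphism_imp_open_map sphere_bundle_open[OF assms(1) W(1) m k sub] by blast
  then have "openin (top_of_set ((F2 \<circ> f_r r) ` (S3 \<times> S2))) (?f ` (M \<inter> W))"
    unfolding image_F2_f_r[OF r(1,2)] r(3) .
  then show "\<exists>Op. open Op \<and> x \<in> Op \<and>
           (\<exists>a b c r. a \<in> S3 \<and> b \<in> S3 \<and> c \<in> S3 \<and> 0 < r \<and> r \<le> 1 \<and>
              openin (top_of_set ((F2 \<circ> f_r r) ` (S3 \<times> S2))) (Fabc a b c ` (M \<inter> Op)))"
    using W(1,2) one qcnj_S3[OF m] r(1,2) by metis
qed

end
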